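(* Let $X_1=X_2=X_3=[0,1]$, each $\mu_{ij}$ Lebesgue measure on $[0,1]^2$, and $c=x_1x_2x_3$. Suppose $f_{12},f_{13},f_{23}:[0,1]^2\to\mathbb{R}$ are continuous, satisfy $f_{12}(x_1,x_2)+f_{13}(x_1,x_3)+f_{23}(x_2,x_3)\le x_1x_2x_3$ for all $(x_1,x_2,x_3)\in[0,1]^3$, and maximize $\sum_{i<j}\int_{[0,1]^2}f_{ij}\,dx_i\,dx_j$ among all tuples of integrable functions satisfying this inequality. Then there exist continuous functions $f_1,f_2,f_3:[0,1]\to\mathbb{R}$ such that $f_{12}(x_1,x_2)=f(x_1,x_2)+f_1(x_1)-f_2(x_2)$, $f_{23}(x_2,x_3)=f(x_2,x_3)+f_2(x_2)-f_3(x_3)$, $f_{13}(x_1,x_3)=f(x_1,x_3)+f_3(x_3)-f_1(x_1)$, where $$f(x,y)=\int_0^x\!\!\int_0^y s\oplus t\,ds\,dt-\frac14\int_0^x\!\!\int_0^x s\oplus t\,ds\,dt-\frac14\int_0^y\!\!\int_0^y s\oplus t\,ds\,dt.$$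
   Context: For $x,y\in[0,1]$, $x\oplus y$ is the bitwise XOR of binary expansions: write $x=\overline{0.x_1x_2\dots}_2$, $y=\overline{0.y_1y_2\dots}_2$, using for dyadic rationals less than $1$ the expansion with finitely many ones and for $1$ the expansion $0.111\dots$; then $x\oplus y=\overline{0.(x_1\oplus y_1)(x_2\oplus y_2)\dots}_2$ with $\oplus$ addition mod $2$ on digits. *)

theory Defs
  imports "HOL-Analysis.Analysis"
begin

text \<open>k-th binary digit (k \<ge> 1) of x \<in> [0,1]: for x < 1 the expansion with finitely
  many ones (floor-based), for x = 1 the expansion 0.111...\<close>
definition bdigit :: "real \<Rightarrow> nat \<Rightarrow> nat" where
  "bdigit x k = (if x = 1 then 1 else nat \<lfloor>2 ^ k * x\<rfloor> mod 2)"

definition bxor :: "real \<Rightarrow> real \<Rightarrow> real" where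
  "bxor x y = (\<Sum>k. real ((bdigit x (Suc k) + bdigit y (Suc k)) mod 2) / 2 ^ Suc k)"

definition xorF :: "real \<Rightarrow> real \<Rightarrow> real" where
  "xorF x y =
     integral ({0..y} \<times> {0..x}) (\<lambda>(s, t). bxor s t)
     - 1/4 * integral ({0..x} \<times> {0..x}) (\<lambda>(s, t). bxor s t)
     - 1/4 * integral ({0..y} \<times> {0..y}) (\<lambda>(s, t). bxor s t)"

definition unit_sq :: "(real \<times> real) set" where
  "unit_sq = {0..1} \<times> {0..1}"

end

theory Submission
  imports Defs
begin

text \<open>
  Write \<open>G = x y z - f\<^sub>1\<^sub>2(x,y) - f\<^sub>1\<^sub>3(x,z) - f\<^sub>2\<^sub>3(y,z) \<ge> 0\<close>.
  The potentials \<open>xorF\<close> are feasible and tight on \<open>z = x \<oplus> y\<close>: on a dyadic grid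
  \<open>G\<close> becomes the integer expression \<open>xgap\<close>, and a reflection \<open>x \<mapsto> 1 - x\<close> changes \<open>G\<close> by
  \<open>(1 - 2x)(1 - 2y)(1 - 2z)/4\<close>, so that nonnegativity on \<open>[0,1]\<^sup>3\<close> reduces to
  nonnegativity on \<open>[0,1/2]\<^sup>3\<close>, which is the same integer statement one level lower.

  Comparing Riemann sums, where \<open>b \<mapsto> a \<oplus> b\<close> permutes the columns, optimality forces \<open>G = 0\<close>
  on \<open>z = x \<oplus> y\<close> for every optimal continuous tuple. Hence, on a dyadic cube of side \<open>h\<close> based
  at such a point, \<open>G\<close> vanishes at the four even vertices, and as the third difference
  of \<open>x y z\<close> is \<open>h\<^sup>3\<close>, the four nonnegative values at the odd vertices add up to
  \<open>h\<^sup>3\<close>. This pins the mixed difference of \<open>f\<^sub>1\<^sub>2\<close> over a dyadic square to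
  \<open>h\<^sup>2 (x \<oplus> y) + O(h\<^sup>3)\<close>, i.e. \<open>f\<^sub>1\<^sub>2\<close> is the integral of \<open>s \<oplus> t\<close> up to functions of one
  variable. Those are determined by \<open>G = 0\<close> on the lines \<open>(x,0,x)\<close>, \<open>(0,x,x)\<close>, \<open>(x,x,0)\<close>.
\<close>

section \<open>Bitwise exclusive or on dyadic grids\<close>

text \<open>Peels off the lowest bit; the inductions on the number of bits in the \<open>xor\<close>
  lemmas below all use it.\<close>

lemma xor_split:
  fixes a b :: nat
  shows "xor a b = 2 * xor (a div 2) (b div 2) + (a + b) mod 2"
  by (subst xor_rec) (auto simp: mod2_eq_if)

lemma xor_double_add:
  fixes a b d e :: nat
  assumes "d < 2" "e < 2"
  shows "xor (2 * a + d) (2 * b + e) = 2 * xor a b + (d + e) mod 2"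
proof -
  have "(2 * a + d + (2 * b + e)) mod 2 = (d + e) mod 2"
    by presburger
  then show ?thesis
    using assms by (subst xor_split) simp
qed

lemma xor_less_power2:
  fixes a b :: nat
  assumes "a < 2 ^ n" "b < 2 ^ n"
  shows "xor a b < 2 ^ n"
  using assms
proof (induction n arbitrary: a b)
  case (Suc n)
  have "xor (a div 2) (b div 2) < 2 ^ n"
    using Suc.prems by (intro Suc.IH) auto
  moreover have "(a + b) mod 2 < 2" by simp
  ultimately show ?case
    unfolding xor_split [of a b] power_Suc by linarith
qed simp

text \<open>Subtracting \<open>a\<close> from \<open>2 ^ n - 1\<close> flips all of its
  \<open>n\<close> bits, hence flips all \<open>n\<close> bits of the exclusive or, and a number and
  its complement add up to \<open>2 ^ n - 1\<close>.\<close>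

lemma xor_complement:
  fixes a b :: nat
  assumes "a < 2 ^ n" "b < 2 ^ n"
  shows "xor (2 ^ n - 1 - a) b + xor a b = 2 ^ n - 1"
  using assms
proof (induction n arbitrary: a b)
  case (Suc n)
  have IH: "xor (2 ^ n - 1 - a div 2) (b div 2) + xor (a div 2) (b div 2) = 2 ^ n - 1"
    using Suc.prems by (intro Suc.IH) auto
  have d: "(2 ^ Suc n - 1 - a) div 2 = 2 ^ n - 1 - a div 2"
    using Suc.prems by simp
  have m: "(2 ^ Suc n - 1 - a + b) mod 2 + (a + b) mod 2 = 1"
  proof -
    have "odd (2 ^ Suc n - 1 - a) \<longleftrightarrow> even a"
    proof -
      have "\<not> 2 ^ Suc n < 1 + a" using Suc.prems(1) by simp
      then have "even (2 ^ Suc n - (1 + a)) \<longleftrightarrow> even (2 ^ Suc n + (1 + a))"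
        by (metis even_diff_nat)
      also have "\<dots> \<longleftrightarrow> odd a" by simp
      finally show ?thesis by simp
    qed
    then show ?thesis
      by (cases "even a"; cases "even b") (simp_all only: mod2_eq_if even_add, simp_all)
  qed
  have "xor (2 ^ Suc n - 1 - a) b + xor a b
      = 2 * (xor (2 ^ n - 1 - a div 2) (b div 2) + xor (a div 2) (b div 2))
        + ((2 ^ Suc n - 1 - a + b) mod 2 + (a + b) mod 2)"
    unfolding xor_split [of "2 ^ Suc n - 1 - a"] xor_split [of a] d by (simp only: distrib_left ac_simps)
  also have "\<dots> = 2 * (2 ^ n - 1) + 1" unfolding IH m ..
  also have "\<dots> = 2 ^ Suc n - 1"
    using one_le_power [of "2 :: nat" n] unfolding power_Suc by linarith
  finally show ?case .
qed simp

lemma xor_add_power2: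
  fixes a b :: nat
  assumes "a < 2 ^ n" "b < 2 ^ n"
  shows "xor (2 ^ n + a) b = 2 ^ n + xor a b"
  using assms
proof (induction n arbitrary: a b)
  case (Suc n)
  have IH: "xor (2 ^ n + a div 2) (b div 2) = 2 ^ n + xor (a div 2) (b div 2)"
    using Suc.prems by (intro Suc.IH) auto
  have d: "(2 ^ Suc n + a) div 2 = 2 ^ n + a div 2" by simp
  have m: "(2 ^ Suc n + a + b) mod 2 = (a + b) mod 2" by (simp add: add.assoc)
  show ?case
    apply (subst xor_split [of "2 ^ Suc n + a"], subst xor_split [of a])
    unfolding d m IH by simp
qed (simp add: numeral_eq_Suc)

text \<open>Blocks of high and low bits do not interact. This is the self-similarity of the graph of
  exclusive or: a grid point on it stays on it under refinement, and each finer cell carries a copy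
  of the whole graph.\<close>

lemma xor_scale_add:
  fixes a b c d :: nat
  assumes "c < 2 ^ m" "d < 2 ^ m"
  shows "xor (2 ^ m * a + c) (2 ^ m * b + d) = 2 ^ m * xor a b + xor c d"
  using assms
proof (induction m arbitrary: c d)
  case (Suc m)
  have e: "(2 ^ Suc m * u + v) div 2 = 2 ^ m * u + v div 2"
          "(2 ^ Suc m * u + v) mod 2 = v mod 2" for u v :: nat
    by (simp_all add: mult.assoc)
  have "xor (2 ^ m * a + c div 2) (2 ^ m * b + d div 2) = 2 ^ m * xor a b + xor (c div 2) (d div 2)"
    using Suc.prems by (intro Suc.IH) auto
  moreover have "(2 ^ Suc m * a + c + (2 ^ Suc m * b + d)) mod 2 = (c + d) mod 2"
    by (metis e(2) mod_add_eq)
  ultimately show ?case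
    by (subst xor_split, subst xor_split [of c]) (simp only: e, simp)
qed simp

lemma xor_cancel_left: "xor (a :: nat) (xor a b) = b"
  by (metis xor.assoc xor.left_neutral xor_self_eq)

lemma bij_betw_xor:
  assumes "a < 2 ^ n"
  shows "bij_betw (xor a) {..<2 ^ n} {..<(2 ^ n :: nat)}"
  by (rule bij_betw_byWitness [where f' = "xor a"])
     (use assms in \<open>auto simp: xor_cancel_left xor_less_power2\<close>)

text \<open>
  With \<open>N = 2^n\<close>, the cell of side \<open>1/N\<close> at \<open>(a/N, b/N)\<close> contributes
  \<open>(2 (a \<oplus> b) + 1) / (2 N\<^sup>3)\<close> to the integral of \<open>s \<oplus> t\<close>; accordingly \<open>xgap i j k / (4 N\<^sup>3)\<close> is
  the slack of the potentials \<open>xorF\<close> at the grid point \<open>(i/N, j/N, k/N)\<close>.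
\<close>
definition xsum :: "nat \<Rightarrow> nat \<Rightarrow> real" where
  "xsum i j = (\<Sum>a<i. \<Sum>b<j. 2 * real (xor a b) + 1)"

section \<open>Reflection of the grid sums\<close>

lemma xsum_commute: "xsum i j = xsum j i"
  unfolding xsum_def by (subst sum.swap) (simp add: xor.commute)

lemma xsum_0 [simp]: "xsum 0 j = 0" "xsum i 0 = 0"
  by (simp_all add: xsum_def)

text \<open>The left side sums the first \<open>i\<close> and the last \<open>i\<close> rows.
  Pairing row \<open>a\<close> with row \<open>2 ^ n - 1 - a\<close>, \<open>xor_complement\<close>
  makes every pair of entries contribute \<open>2 * 2 ^ n\<close>.\<close>

lemma xsum_add:
  assumes i: "i \<le> 2 ^ n" and j: "j \<le> 2 ^ n"
  shows "xsum i j + xsum (2 ^ n) j - xsum (2 ^ n - i) j = 2 * 2 ^ n * real i * real j"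
proof -
  let ?N = "2 ^ n :: nat"
  let ?c = "\<lambda>a. \<Sum>b<j. 2 * real (xor a b) + 1"
  have "sum ?c {..<?N} = sum ?c {..<?N - i} + sum ?c {?N - i..<?N}"
    by (subst sum.union_disjoint [symmetric]) (auto intro!: sum.cong)
  then have 1: "xsum ?N j - xsum (?N - i) j = sum ?c {?N - i..<?N}"
    by (simp add: xsum_def)
  also have "\<dots> = (\<Sum>a<i. ?c (?N - 1 - a))"
    by (rule sum.reindex_bij_witness [where i = "\<lambda>a. ?N - 1 - a" and j = "\<lambda>a. ?N - 1 - a"])
       (use i in auto)
  finally have "xsum i j + xsum ?N j - xsum (?N - i) j
      = (\<Sum>a<i. \<Sum>b<j. (2 * real (xor a b) + 1) + (2 * real (xor (?N - 1 - a) b) + 1))"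
    by (simp add: xsum_def sum.distrib)
  also have "\<dots> = (\<Sum>a<i. \<Sum>b<j. 2 * real ?N)"
  proof (intro sum.cong refl)
    fix a b assume "a \<in> {..<i}" "b \<in> {..<j}"
    then have "xor (?N - 1 - a) b + xor a b = ?N - 1"
      using i j by (intro xor_complement) auto
    then have "real (xor (?N - 1 - a) b) + real (xor a b) = real ?N - 1"
      by (metis of_nat_add of_nat_1 of_nat_diff one_le_numeral one_le_power)
    then show "2 * real (xor a b) + 1 + (2 * real (xor (?N - 1 - a) b) + 1) = 2 * real ?N"
      by simp
  qed
  finally show ?thesis by (simp add: algebra_simps)
qed

lemma xsum_full:
  assumes "j \<le> 2 ^ n"
  shows "xsum (2 ^ n) j = (2 ^ n)\<^sup>2 * real j"
  using xsum_add [of "2 ^ n" n j] assms by (simp add: power2_eq_square)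

lemma xsum_reflect:
  assumes "i \<le> 2 ^ n" "j \<le> 2 ^ n"
  shows "xsum (2 ^ n - i) j = xsum i j + (2 ^ n)\<^sup>2 * real j - 2 * 2 ^ n * real i * real j"
  using xsum_add [of i n j] xsum_full [of j n] assms by simp

section \<open>Nonnegativity and zeros of the discrete slack\<close>

definition xgap :: "nat \<Rightarrow> nat \<Rightarrow> nat \<Rightarrow> real" where
  "xgap i j k = 4 * real i * real j * real k - 2 * (xsum i j + xsum i k + xsum j k)
     + xsum i i + xsum j j + xsum k k"

lemma xgap_commute: "xgap i j k = xgap j i k" "xgap i j k = xgap i k j"
  by (simp_all add: xgap_def xsum_commute algebra_simps)

lemma xgap_reflect:
  assumes "i \<le> 2 ^ n" "j \<le> 2 ^ n" "k \<le> 2 ^ n"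
  shows "xgap (2 ^ n - i) j k
    = xgap i j k + (2 ^ n - 2 * real i) * (2 ^ n - 2 * real j) * (2 ^ n - 2 * real k)"
proof -
  \<comment> \<open>The diagonal term is reflected one argument at a time.\<close>
  have "xsum (2 ^ n - i) (2 ^ n - i)
      = xsum i (2 ^ n - i) + (2 ^ n)\<^sup>2 * real (2 ^ n - i) - 2 * 2 ^ n * real i * real (2 ^ n - i)"
    using assms by (intro xsum_reflect) auto
  moreover have "xsum i (2 ^ n - i) = xsum i i + (2 ^ n)\<^sup>2 * real i - 2 * 2 ^ n * real i * real i"
    using xsum_reflect [of i n i] assms by (simp add: xsum_commute)
  moreover have "real (2 ^ n - i) = 2 ^ n - real i"
    using assms by (simp add: of_nat_diff)
  ultimately show ?thesis
    using assms by (simp add: xgap_def xsum_reflect) (simp add: algebra_simps power2_eq_square)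
qed

text \<open>Reflecting \<open>j\<close> changes the sign of \<open>2 ^ n - 2 * real j\<close>, so
  the corrections of the two reflections cancel.\<close>

lemma xgap_reflect2:
  assumes "i \<le> 2 ^ n" "j \<le> 2 ^ n" "k \<le> 2 ^ n"
  shows "xgap (2 ^ n - i) (2 ^ n - j) k = xgap i j k"
proof -
  have "xgap i (2 ^ n - j) k
      = xgap i j k + (2 ^ n - 2 * real j) * (2 ^ n - 2 * real i) * (2 ^ n - 2 * real k)"
    using assms by (metis xgap_commute(1) xgap_reflect)
  then show ?thesis
    using assms xgap_reflect [of i n "2 ^ n - j" k]
    by (simp add: of_nat_diff algebra_simps)
qed

text \<open>Folding every coordinate into the lower half puts the point where the induction
  hypothesis applies, since \<open>xgap\<close> itself does not depend on \<open>n\<close>. An even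
  number of reflections changes nothing; an odd number amounts to a single one, whose correction is
  a product of three nonnegative factors.\<close>

lemma xgap_nonneg:
  assumes "i \<le> 2 ^ n" "j \<le> 2 ^ n" "k \<le> 2 ^ n"
  shows "xgap i j k \<ge> 0"
  using assms
proof (induction n arbitrary: i j k)
  case 0
  then have "i = 0 \<or> i = 1" "j = 0 \<or> j = 1" "k = 0 \<or> k = 1" by auto
  then show ?case by (auto simp: xgap_def xsum_def)
next
  case (Suc n)
  let ?M = "2 ^ Suc n :: nat"
  have fold: "\<exists>i'\<le>2 ^ n. i = i' \<or> i = ?M - i'" if "i \<le> ?M" for i
    using that by (cases "i \<le> 2 ^ n") (auto intro: exI [of _ "?M - i"])
  obtain a where a: "a \<le> 2 ^ n" "i = a \<or> i = ?M - a" using fold Suc.prems by blast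
  obtain b where b: "b \<le> 2 ^ n" "j = b \<or> j = ?M - b" using fold Suc.prems by blast
  obtain c where c: "c \<le> 2 ^ n" "k = c \<or> k = ?M - c" using fold Suc.prems by blast
  have le: "u \<le> ?M" if "u \<le> 2 ^ n" for u using that by simp
  have odd: "xgap (?M - u) v w \<ge> 0" if "u \<le> 2 ^ n" "v \<le> 2 ^ n" "w \<le> 2 ^ n" for u v w
  proof -
    have "2 ^ Suc n - 2 * real t \<ge> 0" if "t \<le> 2 ^ n" for t
    proof -
      have "real t \<le> 2 ^ n" using that by (metis of_nat_le_iff of_nat_numeral of_nat_power)
      then show ?thesis by simp
    qed
    then have "(2 ^ Suc n - 2 * real u) * (2 ^ Suc n - 2 * real v) * (2 ^ Suc n - 2 * real w) \<ge> 0"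
      using that by (intro mult_nonneg_nonneg) blast+
    moreover have "xgap u v w \<ge> 0" using that by (intro Suc.IH)
    ultimately show ?thesis
      using xgap_reflect [OF that [THEN le]] by linarith
  qed
  have o: "xgap (?M - a) b c \<ge> 0" "xgap a (?M - b) c \<ge> 0" "xgap a b (?M - c) \<ge> 0"
  proof -
    show "xgap (?M - a) b c \<ge> 0" using odd a(1) b(1) c(1) by blast
    show "xgap a (?M - b) c \<ge> 0"
      by (subst xgap_commute(1)) (use odd a(1) b(1) c(1) in blast)
    show "xgap a b (?M - c) \<ge> 0"
      by (subst xgap_commute(2), subst xgap_commute(1)) (rule odd [OF c(1) a(1) b(1)])
  qed
  have e: "xgap a b c \<ge> 0" "xgap (?M - a) (?M - b) c = xgap a b c"
    "xgap (?M - a) (?M - b) (?M - c) = xgap a b (?M - c)"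
    using a(1) b(1) c(1) le by (simp_all add: Suc.IH xgap_reflect2 del: power_Suc)
  have e': "xgap (?M - a) b (?M - c) = xgap a b c"
    using xgap_reflect2 [OF le [OF a(1)] le [OF c(1)] le [OF b(1)]]
    unfolding xgap_commute(2) [of _ b] .
  have "xgap a (?M - b) (?M - c) = xgap (?M - b) a (?M - c)" by (rule xgap_commute)
  also have "\<dots> = xgap (?M - b) (?M - c) a" by (rule xgap_commute)
  also have "\<dots> = xgap b c a"
    by (rule xgap_reflect2 [OF le [OF b(1)] le [OF c(1)] le [OF a(1)]])
  also have "\<dots> = xgap b a c" by (rule xgap_commute)
  also have "\<dots> = xgap a b c" by (rule xgap_commute)
  finally have e'': "xgap a (?M - b) (?M - c) = xgap a b c" .
  from a(2) b(2) c(2) show ?case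
    by (elim disjE; hypsubst) (simp_all only: o e e' e'')
qed

text \<open>As \<open>2 ^ n + i\<close> is \<open>2 ^ Suc n - (2 ^ n - i)\<close>, the shift is a
  composition of double reflections at two consecutive levels.\<close>

lemma xgap_translate:
  assumes "i \<le> 2 ^ n" "j \<le> 2 ^ n" "k \<le> 2 ^ n"
  shows "xgap (2 ^ n + i) (2 ^ n + j) k = xgap i j k"
proof -
  have "xgap (2 ^ Suc n - (2 ^ n - i)) (2 ^ Suc n - (2 ^ n - j)) k = xgap (2 ^ n - i) (2 ^ n - j) k"
    using assms by (intro xgap_reflect2) auto
  also have "\<dots> = xgap i j k" using assms by (rule xgap_reflect2)
  finally show ?thesis using assms by simp
qed

text \<open>Among the top bits of \<open>a\<close>, \<open>b\<close> and \<open>xor a b\<close>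
  either none or exactly two are set, and \<open>xgap_translate\<close> removes such a pair.\<close>

lemma xgap_xor:
  assumes "a < 2 ^ n" "b < 2 ^ n"
  shows "xgap a b (xor a b) = 0"
  using assms
proof (induction n arbitrary: a b)
  case 0
  then show ?case by (simp add: xgap_def)
next
  case (Suc n)
  have split: "\<exists>u<2 ^ n. x = u \<or> x = 2 ^ n + u" if "x < 2 ^ Suc n" for x :: nat
    using that by (cases "x < 2 ^ n") (auto intro: exI [of _ "x - 2 ^ n"])
  obtain u where u: "u < 2 ^ n" "a = u \<or> a = 2 ^ n + u" using split Suc.prems by blast
  obtain v where v: "v < 2 ^ n" "b = v \<or> b = 2 ^ n + v" using split Suc.prems by blast
  have IH: "xgap u v (xor u v) = 0" using u v by (intro Suc.IH)
  have x1: "xor (2 ^ n + u) v = 2 ^ n + xor u v" using u v by (intro xor_add_power2)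
  have x2: "xor u (2 ^ n + v) = 2 ^ n + xor u v" using u v by (metis xor.commute xor_add_power2)
  have x3: "xor (2 ^ n + u) (2 ^ n + v) = xor u v"
    using xor_scale_add [of u n v 1 1] u v by simp
  have lt: "xor u v < 2 ^ n" using u v by (intro xor_less_power2)
  have tr1: "xgap (2 ^ n + u) (2 ^ n + v) (xor u v) = 0"
    using xgap_translate [of u n v "xor u v"] IH lt u v by (simp add: less_imp_le)
  have "xgap u (xor u v) v = 0" "xgap v (xor u v) u = 0"
    using IH by (metis xgap_commute)+
  then have "xgap (2 ^ n + u) (2 ^ n + xor u v) v = 0" "xgap (2 ^ n + v) (2 ^ n + xor u v) u = 0"
    using xgap_translate [of u n "xor u v" v] xgap_translate [of v n "xor u v" u] lt u v
    by (simp_all add: less_imp_le)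
  then have tr2: "xgap (2 ^ n + u) v (2 ^ n + xor u v) = 0" "xgap u (2 ^ n + v) (2 ^ n + xor u v) = 0"
    by (metis xgap_commute)+
  show ?case using u(2) v(2) by (elim disjE) (simp_all add: IH x1 x2 x3 tr1 tr2)
qed

section \<open>The function bxor\<close>

lemma bxor_summand_le: "real ((bdigit x (Suc k) + bdigit y (Suc k)) mod 2) / 2 ^ Suc k \<le> (1 / 2) ^ Suc k"
proof -
  have "real ((bdigit x (Suc k) + bdigit y (Suc k)) mod 2) \<le> 1"
    using mod_less_divisor [of 2 "bdigit x (Suc k) + bdigit y (Suc k)"] by linarith
  then show ?thesis by (simp add: power_divide divide_right_mono)
qed

lemma summable_bxor: "summable (\<lambda>k. real ((bdigit x (Suc k) + bdigit y (Suc k)) mod 2) / 2 ^ Suc k)"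
  by (rule summable_comparison_test' [where g = "\<lambda>k. (1 / 2) ^ Suc k" and N = 0])
     (use bxor_summand_le [of x _ y] in \<open>auto intro!: summable_mult summable_geometric\<close>)

text \<open>The tail after \<open>n\<close> digits is dominated by a geometric series with sum
  \<open>1 / 2 ^ n\<close>.\<close>

lemma bxor_eq_prefix_add:
  "\<exists>r\<in>{0..1 / 2 ^ n}. bxor x y =
     (\<Sum>k<n. real ((bdigit x (Suc k) + bdigit y (Suc k)) mod 2) / 2 ^ Suc k) + r"
proof
  let ?f = "\<lambda>k. real ((bdigit x (Suc k) + bdigit y (Suc k)) mod 2) / 2 ^ Suc k"
  let ?r = "\<Sum>k. ?f (k + n)"
  show "bxor x y = sum ?f {..<n} + ?r"
    unfolding bxor_def using suminf_split_initial_segment [OF summable_bxor, of x y n] by simp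
  have s: "summable (\<lambda>k. ?f (k + n))"
    using summable_bxor by (rule summable_ignore_initial_segment)
  have g: "(\<lambda>k. (1 / 2) ^ Suc n * (1 / 2) ^ k) sums ((1 / 2) ^ Suc n * (1 / (1 - 1 / 2 :: real)))"
    by (intro sums_mult geometric_sums) simp
  have "?r \<le> (\<Sum>k. (1 / 2) ^ Suc n * (1 / 2) ^ k)"
  proof (rule suminf_le [OF _ s sums_summable [OF g]])
    fix k
    have "?f (k + n) \<le> (1 / 2) ^ Suc (k + n)" by (rule bxor_summand_le)
    then show "?f (k + n) \<le> (1 / 2) ^ Suc n * (1 / 2) ^ k" by (simp add: power_add mult_ac)
  qed
  also have "\<dots> = 1 / 2 ^ n" using g by (simp add: sums_iff power_divide)
  finally show "?r \<in> {0..1 / 2 ^ n}" using suminf_nonneg [OF s] by simp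
qed

lemma bxor_bounds: "bxor x y \<in> {0..1}"
  using bxor_eq_prefix_add [of 0 x y] by auto

text \<open>The point 1 is excluded: its digits follow the convention 0.111..., which disagrees with
  the floors of \<open>2 ^ n * x\<close>.\<close>

lemma nat_floor_power2_Suc:
  assumes "x \<in> {0..<1}"
  shows "nat \<lfloor>2 ^ Suc n * x\<rfloor> = 2 * nat \<lfloor>2 ^ n * x\<rfloor> + bdigit x (Suc n)"
proof -
  have "\<lfloor>2 ^ n * x\<rfloor> = \<lfloor>(2 ^ Suc n * x) / real_of_int 2\<rfloor>" by simp
  also have "\<dots> = \<lfloor>2 ^ Suc n * x\<rfloor> div 2" by (rule floor_divide_real_eq_div) simp
  finally have "nat \<lfloor>2 ^ n * x\<rfloor> = nat \<lfloor>2 ^ Suc n * x\<rfloor> div 2"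
    using assms by (simp add: nat_div_distrib)
  moreover have "bdigit x (Suc n) = nat \<lfloor>2 ^ Suc n * x\<rfloor> mod 2"
    using assms by (simp add: bdigit_def)
  ultimately show ?thesis by simp
qed

lemma bxor_prefix:
  assumes "x \<in> {0..<1}" "y \<in> {0..<1}"
  shows "(\<Sum>k<n. real ((bdigit x (Suc k) + bdigit y (Suc k)) mod 2) / 2 ^ Suc k)
    = real (xor (nat \<lfloor>2 ^ n * x\<rfloor>) (nat \<lfloor>2 ^ n * y\<rfloor>)) / 2 ^ n"
proof (induction n)
  case 0
  have "\<lfloor>x\<rfloor> = 0" "\<lfloor>y\<rfloor> = 0" using assms by (simp_all add: floor_eq_iff)
  then show ?case by simp
next
  case (Suc n)
  have "bdigit z (Suc n) < 2" for z by (simp add: bdigit_def)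
  then have "xor (nat \<lfloor>2 ^ Suc n * x\<rfloor>) (nat \<lfloor>2 ^ Suc n * y\<rfloor>)
    = 2 * xor (nat \<lfloor>2 ^ n * x\<rfloor>) (nat \<lfloor>2 ^ n * y\<rfloor>) + (bdigit x (Suc n) + bdigit y (Suc n)) mod 2"
    unfolding nat_floor_power2_Suc [OF assms(1)] nat_floor_power2_Suc [OF assms(2)]
    by (intro xor_double_add)
  then show ?case
    by (simp only: sum.lessThan_Suc Suc.IH) (simp add: add_divide_distrib)
qed

text \<open>The first \<open>n\<close> digits are constant on the half-open cell and the tail ranges
  within \<open>[0, 1 / 2 ^ n]\<close>; comparing with the midpoint of that range halves the
  error.\<close>

lemma bxor_on_cell:
  assumes "a < 2 ^ n" "b < 2 ^ n"
    and x: "real a / 2 ^ n \<le> x" "x < (real a + 1) / 2 ^ n"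
    and y: "real b / 2 ^ n \<le> y" "y < (real b + 1) / 2 ^ n"
  shows "\<bar>bxor x y - (real (xor a b) + 1 / 2) / 2 ^ n\<bar> \<le> 1 / 2 / 2 ^ n"
proof -
  have *: "u \<in> {0..<1} \<and> nat \<lfloor>2 ^ n * u\<rfloor> = c"
    if "c < 2 ^ n" "real c / 2 ^ n \<le> u" "u < (real c + 1) / 2 ^ n" for u c
  proof -
    have "real (c + 1) \<le> 2 ^ n" using that(1) by (metis Suc_eq_plus1 Suc_leI of_nat_le_iff of_nat_numeral of_nat_power)
    then have "(real c + 1) / 2 ^ n \<le> 1" by simp
    moreover have "0 \<le> real c / 2 ^ n" by simp
    moreover have "\<lfloor>2 ^ n * u\<rfloor> = int c"
      using that(2,3) by (auto simp: floor_eq_iff field_simps)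
    moreover have "0 \<le> u" "u < 1" using calculation(1,2) that(2,3) by linarith+
    ultimately show ?thesis by simp
  qed
  obtain r where "r \<in> {0..1 / 2 ^ n}" "bxor x y = real (xor a b) / 2 ^ n + r"
    using bxor_eq_prefix_add [of n x y] bxor_prefix [of x y n] * [OF assms(1) x] * [OF assms(2) y]
    by auto
  then show ?thesis by (auto simp: abs_le_iff add_divide_distrib)
qed

lemma borel_measurable_bxor: "(\<lambda>(s, t). bxor s t) \<in> borel_measurable borel"
proof -
  have [measurable]: "(\<lambda>x. bdigit x k) \<in> measurable borel (count_space UNIV)" for k
    unfolding bdigit_def by measurable
  show ?thesis
    unfolding bxor_def borel_prod [symmetric] by measurable
qed

lemma bxor_integrable: "(\<lambda>(s, t). bxor s t) integrable_on cbox a b"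
proof -
  have "(\<lambda>(s, t). bxor s t) \<in> borel_measurable (lebesgue_on (cbox a b))"
    by (intro measurable_restrict_space1 measurable_completion) (simp add: borel_measurable_bxor)
  then show ?thesis
    by (rule measurable_bounded_by_integrable_imp_integrable [where g = "\<lambda>_. 1"])
       (use bxor_bounds in \<open>auto intro: abs_le_square_iff [THEN iffD2]\<close>)
qed

section \<open>Integrals over grids of rectangles\<close>

lemma integral_split_fst:
  fixes F :: "real \<times> real \<Rightarrow> real"
  assumes "F integrable_on cbox (a, c) (b, d)" "a \<le> m" "m \<le> b"
  shows "integral (cbox (a, c) (b, d)) F = integral (cbox (a, c) (m, d)) F + integral (cbox (m, c) (b, d)) F"
proof -
  have "cbox (a, c) (b, d) \<inter> {x. x \<bullet> (1, 0) \<le> m} = cbox (a, c) (m, d)"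
       "cbox (a, c) (b, d) \<inter> {x. x \<bullet> (1, 0) \<ge> m} = cbox (m, c) (b, d)"
    using assms(2,3) by (auto simp: cbox_Pair_eq)
  then show ?thesis
    using integral_split [OF assms(1), of "(1, 0)" m] by (simp add: Basis_prod_def)
qed

lemma integral_split_snd:
  fixes F :: "real \<times> real \<Rightarrow> real"
  assumes "F integrable_on cbox (a, c) (b, d)" "c \<le> m" "m \<le> d"
  shows "integral (cbox (a, c) (b, d)) F = integral (cbox (a, c) (b, m)) F + integral (cbox (a, m) (b, d)) F"
proof -
  have "cbox (a, c) (b, d) \<inter> {x. x \<bullet> (0, 1) \<le> m} = cbox (a, c) (b, m)"
       "cbox (a, c) (b, d) \<inter> {x. x \<bullet> (0, 1) \<ge> m} = cbox (a, m) (b, d)"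
    using assms(2,3) by (auto simp: cbox_Pair_eq)
  then show ?thesis
    using integral_split [OF assms(1), of "(0, 1)" m] by (simp add: Basis_prod_def)
qed

lemma integral_grid:
  fixes F :: "real \<times> real \<Rightarrow> real"
  assumes F: "F integrable_on cbox (0, 0) (real i * h, real j * h)" and h: "h \<ge> 0"
  shows "integral (cbox (0, 0) (real i * h, real j * h)) F
    = (\<Sum>a<i. \<Sum>b<j. integral (cbox (real a * h, real b * h) ((real a + 1) * h, (real b + 1) * h)) F)"
proof -
  have column: "integral (cbox (p, 0) (q, real j * h)) F
      = (\<Sum>b<j. integral (cbox (p, real b * h) (q, (real b + 1) * h)) F)"
    if "F integrable_on cbox (p, 0) (q, real j * h)" for p q j
    using that
  proof (induction j)
    case 0
    then show ?case by (simp add: content_Pair)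
  next
    case (Suc j)
    have le: "real j * h \<le> (1 + real j) * h" using h by (simp add: mult_right_mono)
    have "F integrable_on cbox (p, 0) (q, real j * h)"
      by (rule Henstock_Kurzweil_Integration.integrable_subinterval [OF Suc.prems])
         (use le h in \<open>auto simp: cbox_Pair_eq\<close>)
    then show ?case
      using integral_split_snd [OF Suc.prems, of "real j * h"] h le Suc.IH by (simp add: add.commute)
  qed
  show ?thesis using F
  proof (induction i)
    case 0
    then show ?case by (simp add: content_Pair)
  next
    case (Suc i)
    have le: "real i * h \<le> (1 + real i) * h" "0 \<le> real i * h" using h by (simp_all add: mult_right_mono)
    have 1: "F integrable_on cbox (0, 0) (real i * h, real j * h)"
      by (rule Henstock_Kurzweil_Integration.integrable_subinterval [OF Suc.prems])
         (use le h in \<open>auto simp: cbox_Pair_eq\<close>)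
    have 2: "F integrable_on cbox (real i * h, 0) (real (Suc i) * h, real j * h)"
      by (rule Henstock_Kurzweil_Integration.integrable_subinterval [OF Suc.prems])
         (use le h in \<open>auto simp: cbox_Pair_eq intro: order_trans [OF le(2)]\<close>)
    show ?case
      using integral_split_fst [OF Suc.prems, of "real i * h"] le Suc.IH [OF 1] column [OF 2]
      by (simp add: add.commute)
  qed
qed

text \<open>The bound is asked for on the open box alone, since the boundary is negligible; so the
  digit jumps on the sides of dyadic cells do no harm.\<close>

lemma integral_box_approx:
  fixes F :: "real \<times> real \<Rightarrow> real"
  assumes F: "F integrable_on cbox p q" and "\<And>z. z \<in> box p q \<Longrightarrow> \<bar>F z - v\<bar> \<le> e" and "e \<ge> 0"
  shows "\<bar>integral (cbox p q) F - measure lborel (cbox p q) * v\<bar> \<le> e * measure lborel (cbox p q)"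
proof -
  have "((\<lambda>z. F z - v) has_integral (integral (cbox p q) F - measure lborel (cbox p q) * v)) (cbox p q)"
    using has_integral_diff [OF integrable_integral [OF F] has_integral_const [of v p q]] by simp
  then have "((\<lambda>z. if z \<in> box p q then F z - v else 0) has_integral
      (integral (cbox p q) F - measure lborel (cbox p q) * v)) (cbox p q)"
    by (rule has_integral_spike_interior) auto
  then show ?thesis
    using has_integral_bound [of e "\<lambda>z. if z \<in> box p q then F z - v else 0"
        "integral (cbox p q) F - measure lborel (cbox p q) * v" p q] assms(2,3) by auto
qed

text \<open>Serves two purposes: with \<open>bxor\<close> it evaluates \<open>xorI\<close> at grid
  points, with a continuous integrand it gives convergence of Riemann sums.\<close>

lemma integral_grid_approx:
  fixes F :: "real \<times> real \<Rightarrow> real"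
  assumes F: "F integrable_on cbox (0, 0) (real i * h, real j * h)" and h: "h \<ge> 0" and e: "e \<ge> 0"
    and v: "\<And>a b x y. \<lbrakk>a < i; b < j; real a * h < x; x < (real a + 1) * h;
        real b * h < y; y < (real b + 1) * h\<rbrakk> \<Longrightarrow> \<bar>F (x, y) - v a b\<bar> \<le> e"
  shows "\<bar>integral (cbox (0, 0) (real i * h, real j * h)) F - h\<^sup>2 * (\<Sum>a<i. \<Sum>b<j. v a b)\<bar>
    \<le> e * (real i * real j * h\<^sup>2)"
proof -
  let ?C = "\<lambda>a b. cbox (real a * h, real b * h) ((real a + 1) * h, (real b + 1) * h)"
  have cell: "\<bar>integral (?C a b) F - h\<^sup>2 * v a b\<bar> \<le> e * h\<^sup>2" if "a < i" "b < j" for a b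
  proof -
    have "real t * h \<le> (real t + 1) * h" for t using h by (simp add: mult_right_mono)
    then have content: "measure lborel (?C a b) = h\<^sup>2"
      by (simp add: content_Pair algebra_simps power2_eq_square)
    have "F integrable_on ?C a b"
    proof (rule Henstock_Kurzweil_Integration.integrable_subinterval [OF F])
      have "(real a + 1) * h \<le> real i * h" "(real b + 1) * h \<le> real j * h"
        "0 \<le> real a * h" "0 \<le> real b * h"
        using that h by (auto intro!: mult_right_mono)
      then show "?C a b \<subseteq> cbox (0, 0) (real i * h, real j * h)"
        by (auto simp: cbox_Pair_eq)
    qed
    then have "\<bar>integral (?C a b) F - measure lborel (?C a b) * v a b\<bar> \<le> e * measure lborel (?C a b)"
      using v that e by (intro integral_box_approx) (auto simp: mem_box Basis_prod_def)
    then show ?thesis unfolding content .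
  qed
  have "integral (cbox (0, 0) (real i * h, real j * h)) F - h\<^sup>2 * (\<Sum>a<i. \<Sum>b<j. v a b)
      = (\<Sum>a<i. \<Sum>b<j. integral (?C a b) F - h\<^sup>2 * v a b)"
    unfolding integral_grid [OF F h] by (simp add: sum_distrib_left sum_subtractf)
  also have "\<bar>\<dots>\<bar> \<le> (\<Sum>a<i. \<Sum>b<j. e * h\<^sup>2)"
    using cell by (intro order_trans [OF sum_abs] sum_mono) auto
  finally show ?thesis by (simp add: mult_ac)
qed

section \<open>Feasibility of xorF\<close>

text \<open>The order of the sides follows \<open>xorF_def\<close>, where the inner variable
  \<open>s\<close> runs up to \<open>y\<close>.\<close>

definition xorI :: "real \<Rightarrow> real \<Rightarrow> real" where
  "xorI x y = integral (cbox (0, 0) (y, x)) (\<lambda>(s, t). bxor s t)"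

lemma xorF_eq: "xorF x y = xorI x y - 1/4 * xorI x x - 1/4 * xorI y y"
  by (simp add: xorF_def xorI_def cbox_Pair_eq)

lemma xorI_0 [simp]: "xorI 0 y = 0" "xorI x 0 = 0"
  by (simp_all add: xorI_def content_Pair)

text \<open>On each cell \<open>bxor\<close> is within \<open>h / 2\<close> of its midpoint value,
  and the cells have total area at most 1. The error vanishes in the later limits over
  \<open>n\<close>.\<close>

lemma xorI_dyadic:
  assumes "i \<le> 2 ^ n" "j \<le> 2 ^ n"
  shows "\<bar>xorI (real i / 2 ^ n) (real j / 2 ^ n) - xsum i j / 2 / (2 ^ n) ^ 3\<bar> \<le> 1 / 2 / 2 ^ n"
proof -
  define h :: real where "h = 1 / 2 ^ n"
  have h: "h > 0" by (simp add: h_def)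
  have "\<bar>integral (cbox (0, 0) (real j * h, real i * h)) (\<lambda>(s, t). bxor s t)
      - h\<^sup>2 * (\<Sum>b<j. \<Sum>a<i. (real (xor b a) + 1 / 2) * h)\<bar> \<le> h / 2 * (real j * real i * h\<^sup>2)"
  proof (rule integral_grid_approx)
    fix b a x y
    assume *: "b < j" "a < i" "real b * h < x" "x < (real b + 1) * h"
      "real a * h < y" "y < (real a + 1) * h"
    then have "\<bar>bxor x y - (real (xor b a) + 1 / 2) / 2 ^ n\<bar> \<le> 1 / 2 / 2 ^ n"
      using assms by (intro bxor_on_cell) (auto simp: h_def)
    then show "\<bar>(case (x, y) of (s, t) \<Rightarrow> bxor s t) - (real (xor b a) + 1 / 2) * h\<bar> \<le> h / 2"
      by (simp add: h_def)
  qed (use h bxor_integrable in auto)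
  moreover have "h\<^sup>2 * (\<Sum>b<j. \<Sum>a<i. (real (xor b a) + 1 / 2) * h) = xsum i j / 2 * h ^ 3"
  proof -
    have "xsum i j = (\<Sum>b<j. \<Sum>a<i. 2 * real (xor b a) + 1)"
      by (subst xsum_commute) (rule xsum_def)
    also have "\<dots> = 2 * (\<Sum>b<j. \<Sum>a<i. real (xor b a) + 1 / 2)"
      by (simp add: sum_distrib_left algebra_simps)
    finally show ?thesis
      by (simp add: sum_distrib_right [symmetric] power2_eq_square power3_eq_cube)
  qed
  moreover have "h / 2 * (real j * real i * h\<^sup>2) \<le> h / 2"
  proof -
    have "real i * h \<le> 1" "real j * h \<le> 1"
      using assms by (simp_all add: h_def)
    then have "(real j * h) * (real i * h) \<le> 1 * 1"
      using h by (intro mult_mono) auto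
    then show ?thesis
      using h mult_left_mono [of "real j * real i * h\<^sup>2" 1 "h / 2"]
      by (simp add: power2_eq_square mult_ac)
  qed
  ultimately show ?thesis
    unfolding xorI_def by (simp add: h_def power_one_over)
qed

lemma xorI_diff_fst:
  assumes "0 \<le> x" "x \<le> x'" "y \<in> {0..1}"
  shows "\<bar>xorI x' y - xorI x y\<bar> \<le> x' - x"
proof -
  have "xorI x' y = xorI x y + integral (cbox (0, x) (y, x')) (\<lambda>(s, t). bxor s t)"
    unfolding xorI_def using assms by (intro integral_split_snd bxor_integrable)
  moreover have "\<bar>integral (cbox (0, x) (y, x')) (\<lambda>(s, t). bxor s t)
      - measure lborel (cbox (0, x) (y, x')) * 0\<bar> \<le> 1 * measure lborel (cbox (0, x) (y, x'))"
    using bxor_bounds by (intro integral_box_approx bxor_integrable) auto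
  moreover have "measure lborel (cbox (0, x) (y, x')) \<le> x' - x"
    using assms mult_left_le_one_le [of "x' - x" y] by (simp add: content_Pair mult.commute)
  ultimately show ?thesis by simp
qed

lemma xorI_diff_snd:
  assumes "0 \<le> y" "y \<le> y'" "x \<in> {0..1}"
  shows "\<bar>xorI x y' - xorI x y\<bar> \<le> y' - y"
proof -
  have "xorI x y' = xorI x y + integral (cbox (y, 0) (y', x)) (\<lambda>(s, t). bxor s t)"
    unfolding xorI_def using assms by (intro integral_split_fst bxor_integrable)
  moreover have "\<bar>integral (cbox (y, 0) (y', x)) (\<lambda>(s, t). bxor s t)
      - measure lborel (cbox (y, 0) (y', x)) * 0\<bar> \<le> 1 * measure lborel (cbox (y, 0) (y', x))"
    using bxor_bounds by (intro integral_box_approx bxor_integrable) auto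
  moreover have "measure lborel (cbox (y, 0) (y', x)) \<le> y' - y"
    using assms mult_left_le_one_le [of "y' - y" x] by (simp add: content_Pair mult.commute)
  ultimately show ?thesis by simp
qed

lemma xorI_lipschitz:
  assumes "x \<in> {0..1}" "x' \<in> {0..1}" "y \<in> {0..1}" "y' \<in> {0..1}"
  shows "\<bar>xorI x y - xorI x' y'\<bar> \<le> \<bar>x - x'\<bar> + \<bar>y - y'\<bar>"
proof -
  have "\<bar>xorI x y - xorI x' y\<bar> \<le> \<bar>x - x'\<bar>"
    using xorI_diff_fst [of x x' y] xorI_diff_fst [of x' x y] assms by (cases "x \<le> x'") auto
  moreover have "\<bar>xorI x' y - xorI x' y'\<bar> \<le> \<bar>y - y'\<bar>"
    using xorI_diff_snd [of y y' x'] xorI_diff_snd [of y' y x'] assms by (cases "y \<le> y'") auto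
  ultimately show ?thesis by linarith
qed

lemma continuous_on_xorI: "continuous_on unit_sq (\<lambda>(x, y). xorI x y)"
proof (rule continuous_onI)
  fix p :: "real \<times> real" and e :: real
  assume p: "p \<in> unit_sq" and e: "0 < e"
  have "dist (case p' of (x, y) \<Rightarrow> xorI x y) (case p of (x, y) \<Rightarrow> xorI x y) \<le> e"
    if p': "p' \<in> unit_sq" and d: "dist p' p < e / 2" for p'
  proof -
    have "dist (fst p') (fst p) < e / 2" "dist (snd p') (snd p) < e / 2"
      using d dist_fst_le [of p' p] dist_snd_le [of p' p] by linarith+
    moreover have "\<bar>xorI (fst p') (snd p') - xorI (fst p) (snd p)\<bar> \<le> \<bar>fst p' - fst p\<bar> + \<bar>snd p' - snd p\<bar>"
      using p p' by (intro xorI_lipschitz) (auto simp: unit_sq_def)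
    ultimately show ?thesis
      by (simp add: dist_real_def split_beta)
  qed
  then show "\<exists>d>0. \<forall>p'\<in>unit_sq. dist p' p < d \<longrightarrow>
      dist (case p' of (x, y) \<Rightarrow> xorI x y) (case p of (x, y) \<Rightarrow> xorI x y) \<le> e"
    using e by (intro exI [of _ "e / 2"]) auto
qed

lemma continuous_on_unit_sq_compose:
  fixes f :: "real \<Rightarrow> real \<Rightarrow> real"
  assumes "continuous_on unit_sq (\<lambda>(x, y). f x y)" "continuous_on S u" "continuous_on S v"
    and "u ` S \<subseteq> {0..1}" "v ` S \<subseteq> {0..1}"
  shows "continuous_on S (\<lambda>x. f (u x) (v x))"
proof -
  have "continuous_on S (\<lambda>x. (\<lambda>(x, y). f x y) (u x, v x))"
    using assms by (intro continuous_on_compose2 [OF assms(1)] continuous_on_Pair)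
      (auto simp: unit_sq_def)
  then show ?thesis by simp
qed

lemma continuous_on_xorF: "continuous_on unit_sq (\<lambda>(x, y). xorF x y)"
  unfolding xorF_eq split_beta
  by (intro continuous_intros continuous_on_unit_sq_compose [OF continuous_on_xorI])
     (auto simp: unit_sq_def)

lemma xorF_gap_dyadic:
  assumes "i \<le> 2 ^ n" "j \<le> 2 ^ n" "k \<le> 2 ^ n"
  defines "x \<equiv> real i / 2 ^ n" and "y \<equiv> real j / 2 ^ n" and "z \<equiv> real k / 2 ^ n"
  shows "\<bar>x * y * z - (xorF x y + xorF x z + xorF y z) - xgap i j k / 4 / (2 ^ n) ^ 3\<bar> \<le> 3 / 2 ^ n"
proof -
  define h :: real where "h = 1 / 2 ^ n"
  have h: "h > 0" by (simp add: h_def)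
  have I: "\<bar>xorI (real i / 2 ^ n) (real j / 2 ^ n) - xsum i j / 2 * h ^ 3\<bar> \<le> h / 2"
    if "i \<le> 2 ^ n" "j \<le> 2 ^ n" for i j
    using xorI_dyadic [OF that] by (simp add: h_def power_one_over)
  have "x * y * z = real i * real j * real k * h ^ 3"
    by (simp add: x_def y_def z_def h_def power3_eq_cube)
  \<comment> \<open>Each diagonal integral occurs in two of the three potentials, so its weight is
    1/2. The six errors of size \<open>h / 2\<close> then total at most
    \<open>9/4 * h\<close>.\<close>
  then have "x * y * z - (xorF x y + xorF x z + xorF y z) - xgap i j k / 4 * h ^ 3
    = - (xorI x y - xsum i j / 2 * h ^ 3) - (xorI x z - xsum i k / 2 * h ^ 3) - (xorI y z - xsum j k / 2 * h ^ 3)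
      + 1/2 * ((xorI x x - xsum i i / 2 * h ^ 3) + (xorI y y - xsum j j / 2 * h ^ 3) + (xorI z z - xsum k k / 2 * h ^ 3))"
    by (simp add: xorF_eq xgap_def algebra_simps add_divide_distrib diff_divide_distrib)
  moreover have "\<bar>E\<bar> \<le> 3 * h"
    if "E = - p - q - r + 1/2 * (s + t + u)" "\<bar>p\<bar> \<le> h / 2" "\<bar>q\<bar> \<le> h / 2" "\<bar>r\<bar> \<le> h / 2"
      "\<bar>s\<bar> \<le> h / 2" "\<bar>t\<bar> \<le> h / 2" "\<bar>u\<bar> \<le> h / 2" for E p q r s t u
    using that h by argo
  ultimately have "\<bar>x * y * z - (xorF x y + xorF x z + xorF y z) - xgap i j k / 4 * h ^ 3\<bar> \<le> 3 * h"
    unfolding x_def y_def z_def using I assms(1-3) by blast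
  then show ?thesis by (simp add: h_def power_one_over)
qed

section \<open>Dyadic truncation and passage to the limit\<close>

definition dfloor :: "nat \<Rightarrow> real \<Rightarrow> nat" where
  "dfloor n x = nat \<lfloor>2 ^ n * x\<rfloor>"

lemma dfloor_0 [simp]: "dfloor n 0 = 0"
  by (simp add: dfloor_def)

text \<open>Equality occurs at 1, which is its own truncation here, unlike with the digits
  0.111....\<close>

lemma dfloor_le:
  assumes "x \<in> {0..1}"
  shows "dfloor n x \<le> 2 ^ n"
proof -
  have "2 ^ n * x \<le> 2 ^ n" using assms by simp
  then have "\<lfloor>2 ^ n * x\<rfloor> \<le> 2 ^ n"
    by (metis floor_mono floor_numeral_power)
  then show ?thesis by (simp add: dfloor_def nat_le_iff)
qed

lemma dfloor_unit: "x \<in> {0..1} \<Longrightarrow> real (dfloor n x) / 2 ^ n \<in> {0..1}"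
  using dfloor_le [of x n] by simp

lemma tendsto_over_power2: "(\<lambda>n. c / 2 ^ n :: real) \<longlonglongrightarrow> 0"
  using tendsto_mult [OF tendsto_const LIMSEQ_realpow_zero [of "1 / 2 :: real"], of c] by (simp add: power_one_over)

lemma tendsto_dfloor:
  assumes "x \<in> {0..1}"
  shows "(\<lambda>n. real (dfloor n x) / 2 ^ n) \<longlonglongrightarrow> x"
proof (rule tendsto_sandwich)
  have e: "real (dfloor n x) = of_int \<lfloor>2 ^ n * x\<rfloor>" for n
    using assms by (simp add: dfloor_def)
  have "x - 1 / 2 ^ n \<le> real (dfloor n x) / 2 ^ n" "real (dfloor n x) / 2 ^ n \<le> x" for n
  proof -
    have "(2 ^ n * x - 1) / 2 ^ n \<le> real (dfloor n x) / 2 ^ n"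
      unfolding e by (intro divide_right_mono) (linarith, simp)
    moreover have "real (dfloor n x) / 2 ^ n \<le> (2 ^ n * x) / 2 ^ n"
      unfolding e by (intro divide_right_mono) (linarith, simp)
    ultimately show "x - 1 / 2 ^ n \<le> real (dfloor n x) / 2 ^ n" "real (dfloor n x) / 2 ^ n \<le> x"
      by (simp_all add: diff_divide_distrib)
  qed
  then show "\<forall>\<^sub>F n in sequentially. x - 1 / 2 ^ n \<le> real (dfloor n x) / 2 ^ n"
    "\<forall>\<^sub>F n in sequentially. real (dfloor n x) / 2 ^ n \<le> x" by simp_all
  show "(\<lambda>n. x - 1 / 2 ^ n) \<longlonglongrightarrow> x"
    using tendsto_diff [OF tendsto_const tendsto_over_power2, of x 1] by simp
qed auto

lemma tendsto_unit_sq_compose: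
  fixes f :: "real \<Rightarrow> real \<Rightarrow> real"
  assumes "continuous_on unit_sq (\<lambda>(x, y). f x y)" "u \<longlonglongrightarrow> x" "v \<longlonglongrightarrow> y"
    and "x \<in> {0..1}" "y \<in> {0..1}" "\<And>n. u n \<in> {0..1}" "\<And>n. v n \<in> {0..1}"
  shows "(\<lambda>n. f (u n) (v n)) \<longlonglongrightarrow> f x y"
  using continuous_on_tendsto_compose [OF assms(1) tendsto_Pair [OF assms(2,3)]] assms(4-)
  by (simp add: unit_sq_def)

lemma xorF_feasible:
  assumes "x \<in> {0..1}" "y \<in> {0..1}" "z \<in> {0..1}"
  shows "xorF x y + xorF x z + xorF y z \<le> x * y * z"
proof -
  let ?d = "\<lambda>n x. real (dfloor n x) / 2 ^ n"
  \<comment> \<open>Adding the error bound of \<open>xorF_gap_dyadic\<close> makes every term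
    nonnegative without changing the limit.\<close>
  let ?G = "\<lambda>n. ?d n x * ?d n y * ?d n z
    - (xorF (?d n x) (?d n y) + xorF (?d n x) (?d n z) + xorF (?d n y) (?d n z)) + 3 / 2 ^ n"
  have "?G \<longlonglongrightarrow> x * y * z - (xorF x y + xorF x z + xorF y z) + 0"
    using assms by (intro tendsto_intros tendsto_unit_sq_compose [OF continuous_on_xorF]
        tendsto_dfloor tendsto_over_power2 dfloor_unit)
  moreover have "0 \<le> ?G n" for n
  proof -
    have "0 \<le> xgap (dfloor n x) (dfloor n y) (dfloor n z) / 4 / (2 ^ n) ^ 3"
      using xgap_nonneg [of "dfloor n x" n "dfloor n y" "dfloor n z"] assms dfloor_le by simp
    then show ?thesis
      using xorF_gap_dyadic [OF assms [THEN dfloor_le], of n] by linarith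
  qed
  ultimately have "0 \<le> x * y * z - (xorF x y + xorF x z + xorF y z) + 0"
    by (intro LIMSEQ_le_const) auto
  then show ?thesis by simp
qed

section \<open>Tightness of optimal potentials\<close>

lemma riemann_sums_tendsto:
  fixes f :: "real \<Rightarrow> real \<Rightarrow> real"
  assumes f: "continuous_on unit_sq (\<lambda>(x, y). f x y)"
  shows "(\<lambda>n. (\<Sum>a<2 ^ n. \<Sum>b<2 ^ n. f (real a / 2 ^ n) (real b / 2 ^ n)) / (2 ^ n)\<^sup>2)
    \<longlonglongrightarrow> integral unit_sq (\<lambda>(x, y). f x y)"
proof (rule LIMSEQ_I)
  fix r :: real assume r: "0 < r"
  have sq: "unit_sq = cbox (0, 0) (1, 1)" by (simp add: unit_sq_def cbox_Pair_eq)
  have "uniformly_continuous_on unit_sq (\<lambda>(x, y). f x y)"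
    using f unfolding sq by (intro compact_uniformly_continuous compact_cbox)
  then obtain d where d: "d > 0" and unif:
    "\<And>p q. p \<in> unit_sq \<Longrightarrow> q \<in> unit_sq \<Longrightarrow> dist q p < d \<Longrightarrow>
      dist ((\<lambda>(x, y). f x y) q) ((\<lambda>(x, y). f x y) p) < r / 2"
    unfolding uniformly_continuous_on_def using r by (metis half_gt_zero)
  then have close: "\<bar>f x y - f x' y'\<bar> \<le> r / 2"
    if "x \<in> {0..1}" "y \<in> {0..1}" "x' \<in> {0..1}" "y' \<in> {0..1}" "dist (x, y) (x', y') < d" for x y x' y'
    using unif [of "(x', y')" "(x, y)"] that by (simp add: unit_sq_def dist_real_def)
  have "\<forall>\<^sub>F n in sequentially. 2 / 2 ^ n < d"
    using order_tendstoD(2) [OF tendsto_over_power2 d, of 2] .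
  then obtain M where M: "\<And>n. n \<ge> M \<Longrightarrow> 2 / 2 ^ n < d"
    by (auto simp: eventually_sequentially)
  show "\<exists>M. \<forall>n\<ge>M. norm ((\<Sum>a<2 ^ n. \<Sum>b<2 ^ n. f (real a / 2 ^ n) (real b / 2 ^ n)) / (2 ^ n)\<^sup>2
      - integral unit_sq (\<lambda>(x, y). f x y)) < r"
  proof (intro exI allI impI)
    fix n assume n: "M \<le> n"
    define h :: real where "h = 1 / 2 ^ n"
    have h: "h > 0" "real (2 ^ n) * h = 1" by (simp_all add: h_def)
    have "\<bar>integral (cbox (0, 0) (real (2 ^ n) * h, real (2 ^ n) * h)) (\<lambda>(x, y). f x y)
       - h\<^sup>2 * (\<Sum>a<2 ^ n. \<Sum>b<2 ^ n. f (real a * h) (real b * h))\<bar>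
       \<le> r / 2 * (real (2 ^ n) * real (2 ^ n) * h\<^sup>2)"
    proof (rule integral_grid_approx)
      show "(\<lambda>(x, y). f x y) integrable_on cbox (0, 0) (real (2 ^ n) * h, real (2 ^ n) * h)"
        using f unfolding h(2) sq by (rule integrable_continuous)
      fix a b x y
      assume *: "a < (2 :: nat) ^ n" "b < (2 :: nat) ^ n" "real a * h < x" "x < (real a + 1) * h"
        "real b * h < y" "y < (real b + 1) * h"
      have in01: "real a * h \<in> {0..1}" "x \<in> {0..1}"
        if "a < 2 ^ n" "real a * h < x" "x < (real a + 1) * h" for a x
      proof -
        have "real (a + 1) \<le> real (2 ^ n)"
          using that(1) by (subst of_nat_le_iff) simp
        then have "(real a + 1) * h \<le> real (2 ^ n) * h"
          using h(1) by (intro mult_right_mono) auto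
        moreover have "0 \<le> real a * h" using h(1) by simp
        ultimately show "real a * h \<in> {0..1}" "x \<in> {0..1}"
          using that(2,3) unfolding h(2) atLeastAtMost_iff by linarith+
      qed
      have "dist (x, y) (real a * h, real b * h) \<le> dist x (real a * h) + dist y (real b * h)"
        by (simp add: dist_Pair_Pair sqrt_sum_squares_le_sum)
      also have "\<dots> < 2 * h"
        using * by (simp add: dist_real_def algebra_simps)
      also have "\<dots> < d" using M [OF n] by (simp add: h_def)
      finally show "\<bar>(case (x, y) of (x, y) \<Rightarrow> f x y) - f (real a * h) (real b * h)\<bar> \<le> r / 2"
        using close in01 * by simp
    qed (use h r in auto)
    then have "\<bar>integral unit_sq (\<lambda>(x, y). f x y)
       - (\<Sum>a<2 ^ n. \<Sum>b<2 ^ n. f (real a / 2 ^ n) (real b / 2 ^ n)) / (2 ^ n)\<^sup>2\<bar> \<le> r / 2"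
      unfolding h(2) sq [symmetric]
      by (simp add: h_def power_one_over power2_eq_square)
    then show "norm ((\<Sum>a<2 ^ n. \<Sum>b<2 ^ n. f (real a / 2 ^ n) (real b / 2 ^ n)) / (2 ^ n)\<^sup>2
      - integral unit_sq (\<lambda>(x, y). f x y)) < r"
      using r by (simp add: abs_minus_commute)
  qed
qed

text \<open>Together with \<open>sum_xor_rows\<close>: the graph of exclusive or over the grid
  projects bijectively onto each coordinate plane, so averaging a function of two coordinates over
  it is an ordinary Riemann sum.\<close>

lemma sum_xor_columns:
  fixes \<phi> :: "nat \<Rightarrow> nat \<Rightarrow> real"
  shows "(\<Sum>a<2 ^ n. \<Sum>b<2 ^ n. \<phi> a (xor a b)) = (\<Sum>a<2 ^ n. \<Sum>b<2 ^ n. \<phi> a b)"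
  by (intro sum.cong refl sum.reindex_bij_betw [OF bij_betw_xor]) simp

lemma sum_xor_rows:
  fixes \<phi> :: "nat \<Rightarrow> nat \<Rightarrow> real"
  shows "(\<Sum>a<2 ^ n. \<Sum>b<2 ^ n. \<phi> b (xor a b)) = (\<Sum>a<2 ^ n. \<Sum>b<2 ^ n. \<phi> a b)"
  using sum_xor_columns [where n = n and \<phi> = \<phi>] by (subst sum.swap) (simp add: xor.commute)

text \<open>Averages of the gap over the graph tend to the deficit of the tuple against
  \<open>xorF\<close>, which is at most 0 by \<open>opt\<close>. A positive value at one grid point
  would by continuity persist on a fixed fraction of all finer grid points and keep these averages
  away from 0.\<close>

lemma gap_zero_on_xor_grid:
  fixes f12 f13 f23 :: "real \<Rightarrow> real \<Rightarrow> real"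
  defines "G \<equiv> \<lambda>x y z. x * y * z - (f12 x y + f13 x z + f23 y z)"
  assumes cont: "continuous_on unit_sq (\<lambda>(x, y). f12 x y)"
      "continuous_on unit_sq (\<lambda>(x, y). f13 x y)" "continuous_on unit_sq (\<lambda>(x, y). f23 x y)"
    and feas: "\<And>x y z. x \<in> {0..1} \<Longrightarrow> y \<in> {0..1} \<Longrightarrow> z \<in> {0..1} \<Longrightarrow> G x y z \<ge> 0"
    and opt: "3 * integral unit_sq (\<lambda>(x, y). xorF x y)
      \<le> integral unit_sq (\<lambda>(x, y). f12 x y) + integral unit_sq (\<lambda>(x, y). f13 x y)
        + integral unit_sq (\<lambda>(x, y). f23 x y)"
    and ab: "a < 2 ^ n" "b < 2 ^ n"
  shows "G (real a / 2 ^ n) (real b / 2 ^ n) (real (xor a b) / 2 ^ n) = 0"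
proof (rule ccontr)
  let ?avg = "\<lambda>\<phi> n. (\<Sum>a<2 ^ n. \<Sum>b<2 ^ n. \<phi> (real a / 2 ^ n) (real b / 2 ^ n)) / (2 ^ n :: real)\<^sup>2"
  let ?xavg = "\<lambda>H n. (\<Sum>a<2 ^ n. \<Sum>b<2 ^ n. H (real a / 2 ^ n) (real b / 2 ^ n) (real (xor a b) / 2 ^ n))
      / (2 ^ n :: real)\<^sup>2 :: real"
  let ?X = "\<lambda>x y z. x * y * z - (xorF x y + xorF x z + xorF y z)"
  let ?L = "3 * integral unit_sq (\<lambda>(x, y). xorF x y) - (integral unit_sq (\<lambda>(x, y). f12 x y)
     + integral unit_sq (\<lambda>(x, y). f13 x y) + integral unit_sq (\<lambda>(x, y). f23 x y))"
  have in01: "real a / 2 ^ n \<in> {0..1}" if "a < 2 ^ n" for a n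
    using that by (simp add: less_imp_le)
  have avg: "?xavg (\<lambda>x y z. x * y * z - (p x y + q x z + r y z)) n
      = ?xavg (\<lambda>x y z. x * y * z) n - (?avg p n + ?avg q n + ?avg r n)" for p q r n
    using sum_xor_columns [where n = n and \<phi> = "\<lambda>a b. q (real a / 2 ^ n) (real b / 2 ^ n)"]
      sum_xor_rows [where n = n and \<phi> = "\<lambda>a b. r (real a / 2 ^ n) (real b / 2 ^ n)"]
    by (simp add: sum_subtractf sum.distrib add_divide_distrib diff_divide_distrib)
  \<comment> \<open>The average of \<open>x * y * z\<close> over the graph is common to both and
    cancels.\<close>
  have "?xavg G n - ?xavg ?X n
      = 3 * ?avg xorF n - (?avg f12 n + ?avg f13 n + ?avg f23 n)" for n
    unfolding G_def avg by simp
  moreover have "(\<lambda>n. 3 * ?avg xorF n - (?avg f12 n + ?avg f13 n + ?avg f23 n)) \<longlonglongrightarrow> ?L"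
    by (intro tendsto_intros riemann_sums_tendsto cont continuous_on_xorF)
  ultimately have diff: "(\<lambda>n. ?xavg G n - ?xavg ?X n) \<longlonglongrightarrow> ?L" by simp
  \<comment> \<open>By \<open>xgap_xor\<close> the slack of \<open>xorF\<close> on the graph is pure
    discretization error.\<close>
  have X0: "?xavg ?X \<longlonglongrightarrow> 0"
  proof (rule tendsto_0_le [where K = 1])
    have "\<bar>?xavg ?X n\<bar> \<le> 3 / 2 ^ n" for n
    proof -
      have "\<bar>?X (real a / 2 ^ n) (real b / 2 ^ n) (real (xor a b) / 2 ^ n)\<bar> \<le> 3 / 2 ^ n"
        if "a < 2 ^ n" "b < 2 ^ n" for a b
        using xorF_gap_dyadic [of a n b "xor a b"] xgap_xor [OF that] xor_less_power2 [OF that] that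
        by simp
      then have "\<bar>\<Sum>a<2 ^ n. \<Sum>b<2 ^ n. ?X (real a / 2 ^ n) (real b / 2 ^ n) (real (xor a b) / 2 ^ n)\<bar>
          \<le> (\<Sum>a<(2 ^ n :: nat). \<Sum>b<(2 ^ n :: nat). 3 / 2 ^ n)"
        by (intro order_trans [OF sum_abs] sum_mono) auto
      also have "\<dots> = 3 / 2 ^ n * (2 ^ n)\<^sup>2" by (simp add: power2_eq_square)
      finally show ?thesis by (simp add: pos_divide_le_eq)
    qed
    then show "\<forall>\<^sub>F n in sequentially. norm (?xavg ?X n) \<le> norm (3 / 2 ^ n :: real) * 1"
      by (intro always_eventually allI) simp
  qed (rule tendsto_over_power2)
  have limG: "?xavg G \<longlonglongrightarrow> ?L"
    using tendsto_add [OF diff X0] by simp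

  define x y z where "x = real a / 2 ^ n" and "y = real b / 2 ^ n" and "z = real (xor a b) / 2 ^ n"
  have xyz: "x \<in> {0..1}" "y \<in> {0..1}" "z \<in> {0..1}"
    unfolding x_def y_def z_def by (intro in01 ab xor_less_power2)+
  assume "G (real a / 2 ^ n) (real b / 2 ^ n) (real (xor a b) / 2 ^ n) \<noteq> 0"
  then have pos: "G x y z > 0"
    using feas [OF xyz] by (simp add: x_def y_def z_def)
  let ?cube = "{0..1} \<times> {0..1} \<times> {0..1 :: real}"
  have G_cont: "continuous_on ?cube (\<lambda>p. G (fst p) (fst (snd p)) (snd (snd p)))"
    unfolding G_def
    by (intro continuous_intros continuous_on_unit_sq_compose [OF cont(1)]
      continuous_on_unit_sq_compose [OF cont(2)] continuous_on_unit_sq_compose [OF cont(3)]) auto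
  obtain d where d: "d > 0" and close:
    "\<And>p. p \<in> ?cube \<Longrightarrow> dist p (x, y, z) < d \<Longrightarrow>
       dist (G (fst p) (fst (snd p)) (snd (snd p))) (G x y z) < G x y z / 2"
    using G_cont [unfolded continuous_on_iff, rule_format, of "(x, y, z)" "G x y z / 2"] xyz pos by auto
  have d': "G x' y' z' > G x y z / 2"
    if "x' \<in> {0..1}" "y' \<in> {0..1}" "z' \<in> {0..1}" "dist (x', y', z') (x, y, z) < d" for x' y' z'
  proof -
    have "dist (G x' y' z') (G x y z) < G x y z / 2"
      using close [of "(x', y', z')"] that by simp
    then show ?thesis unfolding dist_real_def by linarith
  qed
  have "\<forall>\<^sub>F m in sequentially. 3 / 2 ^ m < d"
    using order_tendstoD(2) [OF tendsto_over_power2 d, of 3] .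
  then obtain M where "\<And>m. m \<ge> M \<Longrightarrow> 3 / 2 ^ m < d"
    by (auto simp: eventually_sequentially)
  \<comment> \<open>Refines until a cube of this side at \<open>(x, y, z)\<close> fits into the
    neighbourhood; the 3 counts one side length per coordinate.\<close>
  then obtain k where k: "3 / 2 ^ (n + k) < d" by (metis le_add2)
  let ?m = "n + k"
  define A B where "A = 2 ^ k * a" and "B = 2 ^ k * b"
  have AB: "A < 2 ^ ?m" "B < 2 ^ ?m" using ab by (simp_all add: A_def B_def power_add)
  have AB_xor: "xor A B = 2 ^ k * xor a b"
    using xor_scale_add [of 0 k 0 a b] by (simp add: A_def B_def)
  have base: "real A / 2 ^ ?m = x" "real B / 2 ^ ?m = y" "real (xor A B) / 2 ^ ?m = z"
    unfolding AB_xor by (simp_all add: A_def B_def x_def y_def z_def power_add)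
  \<comment> \<open>The block over the cell at \<open>(A, B)\<close> holds a fraction
    \<open>1 / (2 ^ ?m)^2\<close> of the graph points, whatever \<open>l\<close> is; elsewhere
    \<open>feas\<close> bounds the summands below by 0.\<close>
  have lower: "G x y z / 2 / (2 ^ ?m)\<^sup>2 \<le> ?xavg G (?m + l)" for l
  proof -
    let ?K = "?m + l"
    let ?F = "\<lambda>(a, b). G (real a / 2 ^ ?K) (real b / 2 ^ ?K) (real (xor a b) / 2 ^ ?K)"
    let ?sub = "\<lambda>(u, v). (2 ^ l * A + u, 2 ^ l * B + v)"
    let ?S = "{..<2 ^ l :: nat} \<times> {..<2 ^ l :: nat}"
    have lt: "2 ^ l * c + u < 2 ^ ?K" if "c < 2 ^ ?m" "u < 2 ^ l" for c u :: nat
    proof -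
      have "2 ^ l * c + u < 2 ^ l * (c + 1)" using that by simp
      also have "\<dots> \<le> 2 ^ l * 2 ^ ?m" using that by (intro mult_left_mono) auto
      finally show ?thesis by (simp add: power_add mult_ac)
    qed
    have near: "\<bar>real (2 ^ l * c + u) / 2 ^ ?K - real c / 2 ^ ?m\<bar> < 1 / 2 ^ ?m" if "u < 2 ^ l" for c u :: nat
    proof -
      have "real (2 ^ l * c + u) / 2 ^ ?K - real c / 2 ^ ?m = real u / 2 ^ l / 2 ^ ?m"
        by (simp add: power_add field_simps)
      moreover have "real u / 2 ^ l / 2 ^ ?m < 1 / 2 ^ ?m"
        using that by (intro divide_strict_right_mono) auto
      ultimately show ?thesis by simp
    qed
    have big: "G x y z / 2 \<le> ?F (?sub (u, v))" if "u < 2 ^ l" "v < 2 ^ l" for u v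
    proof -
      have xs: "xor (2 ^ l * A + u) (2 ^ l * B + v) = 2 ^ l * xor A B + xor u v"
        using that by (rule xor_scale_add)
      have uv: "xor u v < 2 ^ l" using that by (rule xor_less_power2)
      let ?x = "real (2 ^ l * A + u) / 2 ^ ?K" and ?y = "real (2 ^ l * B + v) / 2 ^ ?K"
        and ?z = "real (2 ^ l * xor A B + xor u v) / 2 ^ ?K"
      have "dist (?x, ?y, ?z) (x, y, z) \<le> dist ?x x + dist (?y, ?z) (y, z)"
        unfolding dist_Pair_Pair [of ?x] by (simp add: sqrt_sum_squares_le_sum)
      also have "dist (?y, ?z) (y, z) \<le> dist ?y y + dist ?z z"
        unfolding dist_Pair_Pair [of ?y] by (simp add: sqrt_sum_squares_le_sum)
      finally have "dist (?x, ?y, ?z) (x, y, z) \<le> dist ?x x + (dist ?y y + dist ?z z)" by simp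
      moreover have "dist ?x x < 1 / 2 ^ ?m" "dist ?y y < 1 / 2 ^ ?m" "dist ?z z < 1 / 2 ^ ?m"
        unfolding dist_real_def using near [OF that(1), of A] near [OF that(2), of B] near [OF uv, of "xor A B"]
        unfolding base by blast+
      ultimately have "dist (?x, ?y, ?z) (x, y, z) < d" using k by simp
      moreover have "?x \<in> {0..1}" "?y \<in> {0..1}" "?z \<in> {0..1}"
        by (intro in01 lt AB that uv xor_less_power2)+
      ultimately show ?thesis using d' [of ?x ?y ?z] unfolding xs [symmetric] by (simp add: less_imp_le)
    qed
    have "(2 ^ l)\<^sup>2 * (G x y z / 2) = (\<Sum>p\<in>?S. G x y z / 2)" by (simp add: power2_eq_square)
    also have "\<dots> \<le> (\<Sum>p\<in>?S. ?F (?sub p))"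
      using big by (intro sum_mono) auto
    also have "\<dots> = sum ?F (?sub ` ?S)"
      by (rule sum.reindex_cong [symmetric, where l = ?sub]) (auto simp: inj_on_def)
    also have "\<dots> \<le> sum ?F ({..<2 ^ ?K} \<times> {..<2 ^ ?K})"
    proof (intro sum_mono2 finite_cartesian_product finite_lessThan)
      show "?sub ` ?S \<subseteq> {..<2 ^ ?K} \<times> {..<2 ^ ?K}"
        using lt [OF AB(1)] lt [OF AB(2)] by auto
      have "0 \<le> ?F (a, b)" if "a < 2 ^ ?K" "b < 2 ^ ?K" for a b
        unfolding prod.case by (intro feas in01 that xor_less_power2)
      then show "0 \<le> ?F p" if "p \<in> {..<2 ^ ?K} \<times> {..<2 ^ ?K} - ?sub ` ?S" for p
        using that by blast
    qed
    also have "\<dots> = ?xavg G ?K * (2 ^ ?K)\<^sup>2" by (simp add: sum.cartesian_product)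
    finally show ?thesis by (simp add: power_add power_mult_distrib field_simps)
  qed
  have "(\<lambda>l. ?xavg G (l + ?m)) \<longlonglongrightarrow> ?L" using limG by (rule LIMSEQ_ignore_initial_segment)
  then have "G x y z / 2 / (2 ^ ?m)\<^sup>2 \<le> ?L"
    using lower by (intro LIMSEQ_le_const [of _ ?L]) (auto simp: add.commute)
  moreover have "G x y z / 2 / (2 ^ ?m)\<^sup>2 > 0" using pos by simp
  ultimately show False using opt by linarith
qed

section \<open>Mixed differences of tight potentials\<close>

text \<open>The four even vertices of the cube at \<open>(a, b, xor a b)\<close> need not lie on the
  graph at level \<open>n\<close>, but they are limits of graph points at finer levels inside the
  cube.\<close>

lemma gap_zero_on_xor_cells:
  fixes f12 f13 f23 :: "real \<Rightarrow> real \<Rightarrow> real"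
  defines "G \<equiv> \<lambda>x y z. x * y * z - (f12 x y + f13 x z + f23 y z)"
  assumes cont: "continuous_on unit_sq (\<lambda>(x, y). f12 x y)"
      "continuous_on unit_sq (\<lambda>(x, y). f13 x y)" "continuous_on unit_sq (\<lambda>(x, y). f23 x y)"
    and zero: "\<And>n a b. a < 2 ^ n \<Longrightarrow> b < 2 ^ n \<Longrightarrow>
      G (real a / 2 ^ n) (real b / 2 ^ n) (real (xor a b) / 2 ^ n) = 0"
    and ab: "a < 2 ^ n" "b < 2 ^ n" and uv: "u \<le> 1" "v \<le> 1"
  shows "G (real (a + u) / 2 ^ n) (real (b + v) / 2 ^ n) (real (xor a b + xor u v) / 2 ^ n) = 0"
proof -
  \<comment> \<open>The bits of \<open>c\<close> followed by \<open>l\<close> copies of the bit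
    \<open>w\<close>: this tends to \<open>(c + w) / 2 ^ n\<close>, and exclusive or acts on the
    constant blocks through \<open>u\<close> and \<open>v\<close> alone.\<close>
  let ?p = "\<lambda>l c w. real (2 ^ l * c + w * (2 ^ l - 1)) / 2 ^ (n + l)"
  have xor_uv: "xor u v \<le> 1" using xor_less_power2 [of u 1 v] uv by simp
  have p_eq: "?p l c w = real (c + w) / 2 ^ n - real w / 2 ^ n / 2 ^ l" if "w \<le> 1" for l c w
    by (simp add: power_add field_simps of_nat_diff)
  have p01: "?p l c w \<in> {0..1}" and lt: "2 ^ l * c + w * (2 ^ l - 1) < 2 ^ (n + l)"
    if "c < 2 ^ n" "w \<le> 1" for l c w
  proof -
    have "w * (2 ^ l - 1) \<le> 1 * (2 ^ l - 1)" using that(2) by (intro mult_right_mono) auto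
    then have "2 ^ l * c + w * (2 ^ l - 1) < 2 ^ l * c + 2 ^ l"
      using one_le_power [of "2 :: nat" l] by linarith
    also have "\<dots> = 2 ^ l * (c + 1)" by simp
    also have "\<dots> \<le> 2 ^ l * 2 ^ n" using that(1) by (intro mult_left_mono) auto
    finally show "2 ^ l * c + w * (2 ^ l - 1) < 2 ^ (n + l)" by (simp add: power_add mult.commute)
    then have "real (2 ^ l * c + w * (2 ^ l - 1)) \<le> real (2 ^ (n + l))"
      by (subst of_nat_le_iff) simp
    then show "?p l c w \<in> {0..1}" by simp
  qed
  have lim: "(\<lambda>l. ?p l c w) \<longlonglongrightarrow> real (c + w) / 2 ^ n" if "w \<le> 1" for c w
  proof -
    have "(\<lambda>l. real (c + w) / 2 ^ n - real w / 2 ^ n / 2 ^ l) \<longlonglongrightarrow> real (c + w) / 2 ^ n - 0"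
      by (intro tendsto_intros tendsto_over_power2)
    then show ?thesis unfolding p_eq [OF that] by simp
  qed
  have lim01: "real (c + w) / 2 ^ n \<in> {0..1}" if "c < 2 ^ n" "w \<le> 1" for c w
  proof -
    have "real (c + w) \<le> real (2 ^ n)" using that by (subst of_nat_le_iff) simp
    then show ?thesis by simp
  qed
  have vanish: "G (?p l a u) (?p l b v) (?p l (xor a b) (xor u v)) = 0" for l
  proof -
    have "xor (u * (2 ^ l - 1)) (v * (2 ^ l - 1)) = xor u v * (2 ^ l - 1)"
      using uv by (auto simp: le_Suc_eq)
    moreover have "w * (2 ^ l - 1) < 2 ^ l" if "w \<le> 1" for w :: nat
      using that by (auto simp: le_Suc_eq)
    ultimately have "xor (2 ^ l * a + u * (2 ^ l - 1)) (2 ^ l * b + v * (2 ^ l - 1))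
        = 2 ^ l * xor a b + xor u v * (2 ^ l - 1)"
      using uv by (simp add: xor_scale_add)
    then show ?thesis
      using zero [OF lt [OF ab(1) uv(1)] lt [OF ab(2) uv(2)], of l] by simp
  qed
  have "(\<lambda>l. G (?p l a u) (?p l b v) (?p l (xor a b) (xor u v))) \<longlonglongrightarrow>
      G (real (a + u) / 2 ^ n) (real (b + v) / 2 ^ n) (real (xor a b + xor u v) / 2 ^ n)"
    unfolding G_def using ab uv xor_uv
    by (intro tendsto_intros tendsto_unit_sq_compose [OF cont(1)] tendsto_unit_sq_compose [OF cont(2)]
      tendsto_unit_sq_compose [OF cont(3)] lim p01 lim01 xor_less_power2)
  then show ?thesis
    unfolding vanish by (simp add: LIMSEQ_const_iff)
qed

text \<open>Phrased for the gap of a general triple, so that permuting the variables makes it apply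
  to each of the three potentials.\<close>

lemma mixed_difference_eq_xorI:
  fixes f12 f13 f23 :: "real \<Rightarrow> real \<Rightarrow> real"
  defines "G \<equiv> \<lambda>x y z. x * y * z - (f12 x y + f13 x z + f23 y z)"
  assumes cont: "continuous_on unit_sq (\<lambda>(x, y). f12 x y)"
    and feas: "\<And>x y z. x \<in> {0..1} \<Longrightarrow> y \<in> {0..1} \<Longrightarrow> z \<in> {0..1} \<Longrightarrow> G x y z \<ge> 0"
    and zero: "\<And>n a b u v. a < 2 ^ n \<Longrightarrow> b < 2 ^ n \<Longrightarrow> u \<le> 1 \<Longrightarrow> v \<le> 1 \<Longrightarrow>
      G (real (a + u) / 2 ^ n) (real (b + v) / 2 ^ n) (real (xor a b + xor u v) / 2 ^ n) = 0"
    and xy: "x \<in> {0..1}" "y \<in> {0..1}"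
  shows "f12 x y - f12 x 0 - f12 0 y + f12 0 0 = xorI x y"
proof -
  have grid: "\<bar>f12 (real i / 2 ^ n) (real j / 2 ^ n) - f12 (real i / 2 ^ n) 0 - f12 0 (real j / 2 ^ n) + f12 0 0
      - xorI (real i / 2 ^ n) (real j / 2 ^ n)\<bar> \<le> 1 / 2 ^ n"
    if ij: "i \<le> 2 ^ n" "j \<le> 2 ^ n" for i j n
  proof -
    define h :: real where "h = 1 / 2 ^ n"
    have h: "h > 0" by (simp add: h_def)
    define F where "F = (\<lambda>a b. f12 (real a * h) (real b * h))"
    have cell: "\<bar>F (a + 1) (b + 1) - F (a + 1) b - F a (b + 1) + F a b - (real (xor a b) + 1 / 2) * h ^ 3\<bar>
        \<le> h ^ 3 / 2" if "a < 2 ^ n" "b < 2 ^ n" for a b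
    proof -
      define p q r where "p = real a * h" and "q = real b * h" and "r = real (xor a b) * h"
      have shift: "real (c + 1) * h = real c * h + h" for c by (simp add: algebra_simps)
      have in01: "real c * h \<in> {0..1}" "real c * h + h \<in> {0..1}" if "c < 2 ^ n" for c
      proof -
        have "real (c + 1) \<le> real (2 ^ n)" using that by (subst of_nat_le_iff) simp
        then have "real (c + 1) * h \<le> real (2 ^ n) * h" using h by (intro mult_right_mono) auto
        also have "\<dots> = 1" by (simp add: h_def)
        finally show "real c * h \<in> {0..1}" "real c * h + h \<in> {0..1}"
          using h unfolding shift by auto
      qed
      have even: "G p q r = 0" "G (p + h) (q + h) r = 0" "G (p + h) q (r + h) = 0" "G p (q + h) (r + h) = 0"
        using zero [OF that, of 0 0] zero [OF that, of 1 1] zero [OF that, of 1 0] zero [OF that, of 0 1]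
        by (simp_all add: p_def q_def r_def h_def add_divide_distrib add.commute)
      have odd: "G (p + h) q r \<ge> 0" "G p (q + h) r \<ge> 0" "G p q (r + h) \<ge> 0" "G (p + h) (q + h) (r + h) \<ge> 0"
        unfolding p_def q_def r_def using that xor_less_power2 [OF that] by (intro feas in01; simp)+
      \<comment> \<open>A third difference annihilates functions of two variables, so only that of
        \<open>x * y * z\<close> survives.\<close>
      have "G (p + h) q r + G p (q + h) r + G p q (r + h) + G (p + h) (q + h) (r + h)
         - (G p q r + G (p + h) (q + h) r + G (p + h) q (r + h) + G p (q + h) (r + h)) = h ^ 3"
        unfolding G_def by (simp add: algebra_simps power3_eq_cube)
      then have 1: "G (p + h) q r + G p (q + h) r \<le> h ^ 3"
        using even odd by linarith
      \<comment> \<open>At fixed height \<open>r\<close> the terms of \<open>f13\<close> and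
        \<open>f23\<close> cancel in the mixed difference.\<close>
      have "f12 (p + h) (q + h) - f12 (p + h) q - f12 p (q + h) + f12 p q
        = h * h * r + (G (p + h) q r + G p (q + h) r) - (G p q r + G (p + h) (q + h) r)"
        unfolding G_def by (simp add: algebra_simps)
      then have 2: "f12 (p + h) (q + h) - f12 (p + h) q - f12 p (q + h) + f12 p q
        = h * h * r + (G (p + h) q r + G p (q + h) r)"
        using even by simp
      have "F (a + 1) (b + 1) - F (a + 1) b - F a (b + 1) + F a b
        = real (xor a b) * h ^ 3 + (G (p + h) q r + G p (q + h) r)"
        using 2 unfolding F_def shift p_def q_def r_def by (simp add: power3_eq_cube)
      then have "F (a + 1) (b + 1) - F (a + 1) b - F a (b + 1) + F a b - (real (xor a b) + 1 / 2) * h ^ 3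
        = (G (p + h) q r + G p (q + h) r) - h ^ 3 / 2"
        by (simp add: algebra_simps)
      then show ?thesis
        using 1 odd(1,2) by argo
    qed
    have tele: "(\<Sum>a<i. \<Sum>b<j. F (a + 1) (b + 1) - F (a + 1) b - F a (b + 1) + F a b)
        = F i j - F i 0 - F 0 j + F 0 0"
    proof -
      have "(\<Sum>b<j. F (a + 1) (b + 1) - F (a + 1) b - F a (b + 1) + F a b)
          = (F (Suc a) j - F (Suc a) 0) - (F a j - F a 0)" for a
        using sum_lessThan_telescope [of "\<lambda>b. F (Suc a) b - F a b" j] by (simp add: algebra_simps)
      then show ?thesis
        using sum_lessThan_telescope [of "\<lambda>a. F a j - F a 0" i] by simp
    qed
    have xs: "(\<Sum>a<i. \<Sum>b<j. (real (xor a b) + 1 / 2) * h ^ 3) = xsum i j / 2 * h ^ 3"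
    proof -
      have "xsum i j = 2 * (\<Sum>a<i. \<Sum>b<j. real (xor a b) + 1 / 2)"
        unfolding xsum_def by (simp add: sum_distrib_left algebra_simps)
      then show ?thesis by (simp add: sum_distrib_right [symmetric])
    qed
    have "F i j - F i 0 - F 0 j + F 0 0 - xsum i j / 2 * h ^ 3
      = (\<Sum>a<i. \<Sum>b<j. F (a + 1) (b + 1) - F (a + 1) b - F a (b + 1) + F a b - (real (xor a b) + 1 / 2) * h ^ 3)"
      unfolding tele [symmetric] xs [symmetric] by (simp add: sum_subtractf)
    also have "\<bar>\<dots>\<bar> \<le> (\<Sum>a<i. \<Sum>b<j. h ^ 3 / 2)"
      using cell ij by (intro order_trans [OF sum_abs] sum_mono) auto
    \<comment> \<open>Errors of order \<open>h ^ 3\<close> on at most \<open>1 / h^2\<close> cells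
      still leave a total of order \<open>h\<close>.\<close>
    also have "\<dots> = (real i * h) * (real j * h) * (h / 2)" by (simp add: power3_eq_cube)
    also have "\<dots> \<le> 1 * 1 * (h / 2)"
      using ij h by (intro mult_mono) (auto simp: h_def)
    finally have "\<bar>F i j - F i 0 - F 0 j + F 0 0 - xsum i j / 2 * h ^ 3\<bar> \<le> h / 2" by simp
    moreover have "\<bar>xorI (real i * h) (real j * h) - xsum i j / 2 * h ^ 3\<bar> \<le> h / 2"
      using xorI_dyadic [OF ij] by (simp add: h_def power_one_over)
    ultimately have "\<bar>F i j - F i 0 - F 0 j + F 0 0 - xorI (real i * h) (real j * h)\<bar> \<le> h" by argo
    then show ?thesis by (simp add: F_def h_def)
  qed
  let ?d = "\<lambda>n x. real (dfloor n x) / 2 ^ n"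
  let ?D = "\<lambda>x y. f12 x y - f12 x 0 - f12 0 y + f12 0 0 - xorI x y"
  have "(\<lambda>n. ?D (?d n x) (?d n y)) \<longlonglongrightarrow> ?D x y"
    using xy by (intro tendsto_intros tendsto_unit_sq_compose [OF cont]
        tendsto_unit_sq_compose [OF continuous_on_xorI] tendsto_dfloor dfloor_unit) auto
  moreover have "(\<lambda>n. ?D (?d n x) (?d n y)) \<longlonglongrightarrow> 0"
    by (rule tendsto_0_le [OF tendsto_over_power2 [of 1], where K = 1])
       (use grid [OF dfloor_le dfloor_le] xy in \<open>auto intro!: always_eventually\<close>)
  ultimately show ?thesis using LIMSEQ_unique by fastforce
qed

section \<open>Uniqueness\<close>

theorem mainTheorem18:
  fixes f12 f13 f23 :: "real \<Rightarrow> real \<Rightarrow> real"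
  assumes cont12: "continuous_on unit_sq (\<lambda>(x, y). f12 x y)"
    and cont13: "continuous_on unit_sq (\<lambda>(x, y). f13 x y)"
    and cont23: "continuous_on unit_sq (\<lambda>(x, y). f23 x y)"
    and feas: "\<And>x1 x2 x3. x1 \<in> {0..1} \<Longrightarrow> x2 \<in> {0..1} \<Longrightarrow> x3 \<in> {0..1} \<Longrightarrow>
                 f12 x1 x2 + f13 x1 x3 + f23 x2 x3 \<le> x1 * x2 * x3"
    and opt: "\<And>g12 g13 g23 :: real \<Rightarrow> real \<Rightarrow> real.
                 (\<lambda>(x, y). g12 x y) absolutely_integrable_on unit_sq \<Longrightarrow>
                 (\<lambda>(x, y). g13 x y) absolutely_integrable_on unit_sq \<Longrightarrow>
                 (\<lambda>(x, y). g23 x y) absolutely_integrable_on unit_sq \<Longrightarrow>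
                 (\<forall>x1\<in>{0..1}. \<forall>x2\<in>{0..1}. \<forall>x3\<in>{0..1}.
                    g12 x1 x2 + g13 x1 x3 + g23 x2 x3 \<le> x1 * x2 * x3) \<Longrightarrow>
                 integral unit_sq (\<lambda>(x, y). g12 x y) + integral unit_sq (\<lambda>(x, y). g13 x y)
                   + integral unit_sq (\<lambda>(x, y). g23 x y)
                 \<le> integral unit_sq (\<lambda>(x, y). f12 x y) + integral unit_sq (\<lambda>(x, y). f13 x y)
                   + integral unit_sq (\<lambda>(x, y). f23 x y)"
  shows "\<exists>f1 f2 f3 :: real \<Rightarrow> real.
           continuous_on {0..1} f1 \<and> continuous_on {0..1} f2 \<and> continuous_on {0..1} f3 \<and>
           (\<forall>x1\<in>{0..1}. \<forall>x2\<in>{0..1}. f12 x1 x2 = xorF x1 x2 + f1 x1 - f2 x2) \<and>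
           (\<forall>x2\<in>{0..1}. \<forall>x3\<in>{0..1}. f23 x2 x3 = xorF x2 x3 + f2 x2 - f3 x3) \<and>
           (\<forall>x1\<in>{0..1}. \<forall>x3\<in>{0..1}. f13 x1 x3 = xorF x1 x3 + f3 x3 - f1 x1)"
proof -
  define G where "G = (\<lambda>x y z. x * y * z - (f12 x y + f13 x z + f23 y z))"
  have G_nonneg: "G x y z \<ge> 0" if "x \<in> {0..1}" "y \<in> {0..1}" "z \<in> {0..1}" for x y z
    using feas [OF that] by (simp add: G_def)
  have "unit_sq = cbox (0, 0) (1, 1)" by (simp add: unit_sq_def cbox_Pair_eq)
  then have "(\<lambda>(x, y). xorF x y) absolutely_integrable_on unit_sq"
    using continuous_on_xorF absolutely_integrable_continuous by metis
  then have opt_xorF: "3 * integral unit_sq (\<lambda>(x, y). xorF x y)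
      \<le> integral unit_sq (\<lambda>(x, y). f12 x y) + integral unit_sq (\<lambda>(x, y). f13 x y)
        + integral unit_sq (\<lambda>(x, y). f23 x y)"
    using opt [of xorF xorF xorF] xorF_feasible by simp
  have grid: "G (real a / 2 ^ n) (real b / 2 ^ n) (real (xor a b) / 2 ^ n) = 0"
    if "a < 2 ^ n" "b < 2 ^ n" for a b n
    unfolding G_def
    by (rule gap_zero_on_xor_grid [OF cont12 cont13 cont23 _ opt_xorF that])
       (fact G_nonneg [unfolded G_def])
  have zero: "G (real (a + u) / 2 ^ n) (real (b + v) / 2 ^ n) (real (xor a b + xor u v) / 2 ^ n) = 0"
    if "a < 2 ^ n" "b < 2 ^ n" "u \<le> 1" "v \<le> 1" for n a b u v
    unfolding G_def
    by (rule gap_zero_on_xor_cells [OF cont12 cont13 cont23 _ that]) (fact grid [unfolded G_def])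
  have xor_le: "xor u v \<le> 1" if "u \<le> 1" "v \<le> 1" for u v :: nat
    using xor_less_power2 [of u 1 v] that by simp

  have mixed12: "f12 x y - f12 x 0 - f12 0 y + f12 0 0 = xorI x y"
    if "x \<in> {0..1}" "y \<in> {0..1}" for x y
    by (rule mixed_difference_eq_xorI [OF cont12 _ _ that, of f13 f23])
       (fact G_nonneg [unfolded G_def] zero [unfolded G_def])+
  have mixed13: "f13 x z - f13 x 0 - f13 0 z + f13 0 0 = xorI x z"
    if "x \<in> {0..1}" "z \<in> {0..1}" for x z
  \<comment> \<open>The relation \<open>z = xor x y\<close> is symmetric in the three coordinates,
    so here \<open>y = xor x z\<close> plays the third one.\<close>
  proof (rule mixed_difference_eq_xorI [OF cont13 _ _ that, of f12 "\<lambda>z y. f23 y z"])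
    show "x * z * y - (f13 x z + f12 x y + f23 y z) \<ge> 0"
      if "x \<in> {0..1}" "z \<in> {0..1}" "y \<in> {0..1}" for x z y
      using G_nonneg [OF that(1,3,2)] by (simp add: G_def mult_ac)
    fix n a c u w :: nat
    assume *: "a < 2 ^ n" "c < 2 ^ n" "u \<le> 1" "w \<le> 1"
    show "real (a + u) / 2 ^ n * (real (c + w) / 2 ^ n) * (real (xor a c + xor u w) / 2 ^ n)
        - (f13 (real (a + u) / 2 ^ n) (real (c + w) / 2 ^ n)
          + f12 (real (a + u) / 2 ^ n) (real (xor a c + xor u w) / 2 ^ n)
          + f23 (real (xor a c + xor u w) / 2 ^ n) (real (c + w) / 2 ^ n)) = 0"
      using zero [OF *(1) xor_less_power2 [OF *(1,2)] *(3) xor_le [OF *(3,4)]]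
      unfolding G_def xor_cancel_left by (simp only: mult_ac add_ac)
  qed
  have mixed23: "f23 y z - f23 y 0 - f23 0 z + f23 0 0 = xorI y z"
    if "y \<in> {0..1}" "z \<in> {0..1}" for y z
  proof (rule mixed_difference_eq_xorI [OF cont23 _ _ that, of "\<lambda>y x. f12 x y" "\<lambda>z x. f13 x z"])
    show "y * z * x - (f23 y z + f12 x y + f13 x z) \<ge> 0"
      if "y \<in> {0..1}" "z \<in> {0..1}" "x \<in> {0..1}" for y z x
      using G_nonneg [OF that(3,1,2)] by (simp add: G_def mult_ac)
    fix n b c v w :: nat
    assume *: "b < 2 ^ n" "c < 2 ^ n" "v \<le> 1" "w \<le> 1"
    have "xor (xor b c) b = c" "xor (xor v w) v = w"
      by (metis xor.commute xor_cancel_left)+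
    then show "real (b + v) / 2 ^ n * (real (c + w) / 2 ^ n) * (real (xor b c + xor v w) / 2 ^ n)
        - (f23 (real (b + v) / 2 ^ n) (real (c + w) / 2 ^ n)
          + f12 (real (xor b c + xor v w) / 2 ^ n) (real (b + v) / 2 ^ n)
          + f13 (real (xor b c + xor v w) / 2 ^ n) (real (c + w) / 2 ^ n)) = 0"
      using zero [OF xor_less_power2 [OF *(1,2)] *(1) xor_le [OF *(3,4)] *(3)]
      unfolding G_def by (simp only: mult_ac add_ac)
  qed

  have edge: "G x 0 x = 0 \<and> G 0 x x = 0 \<and> G x x 0 = 0" if x: "x \<in> {0..1}" for x
  proof -
    let ?d = "\<lambda>n. real (dfloor n x) / 2 ^ n"
    have dyadic: "G (?d n) 0 (?d n) = 0 \<and> G 0 (?d n) (?d n) = 0 \<and> G (?d n) (?d n) 0 = 0" for n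
    proof -
      \<comment> \<open>At \<open>x = 1\<close> the index \<open>2 ^ n\<close> is out of range for
        the grid; it is reached as the upper end of the last cell.\<close>
      obtain a u where au: "dfloor n x = a + u" "a < 2 ^ n" "u \<le> 1"
      proof (cases "dfloor n x < 2 ^ n")
        case True
        then show ?thesis using that [of "dfloor n x" 0] by simp
      next
        case False
        then show ?thesis using that [of "2 ^ n - 1" 1] dfloor_le [OF x, of n] by simp
      qed
      show ?thesis
        using zero [OF au(2) _ au(3), of 0 0] zero [OF _ au(2) _ au(3), of 0 0]
          zero [OF au(2) au(2) au(3) au(3)] au(1) by simp
    qed
    have 0: "(\<lambda>n. 0) \<longlonglongrightarrow> (0 :: real)" "(0 :: real) \<in> {0..1}" by simp_all
    note lim = tendsto_unit_sq_compose [OF cont12] tendsto_unit_sq_compose [OF cont13]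
      tendsto_unit_sq_compose [OF cont23]
    have "(\<lambda>n. G (?d n) 0 (?d n)) \<longlonglongrightarrow> G x 0 x" "(\<lambda>n. G 0 (?d n) (?d n)) \<longlonglongrightarrow> G 0 x x"
      "(\<lambda>n. G (?d n) (?d n) 0) \<longlonglongrightarrow> G x x 0"
      unfolding G_def by (intro tendsto_intros lim tendsto_dfloor dfloor_unit x 0)+
    then show ?thesis using dyadic by (simp add: LIMSEQ_const_iff)
  qed

  \<comment> \<open>The one-variable remainders after subtracting \<open>xorF\<close>, whose
    diagonal terms are compensated by the summands with 1/4.\<close>
  define A B C D E H where "A x = 1/4 * xorI x x + f12 x 0" and "B y = 1/4 * xorI y y + f12 0 y - f12 0 0"
    and "C x = 1/4 * xorI x x + f13 x 0" and "D z = 1/4 * xorI z z + f13 0 z - f13 0 0"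
    and "E y = 1/4 * xorI y y + f23 y 0" and "H z = 1/4 * xorI z z + f23 0 z - f23 0 0" for x y z
  have f12_eq: "f12 x y = xorF x y + A x + B y" if "x \<in> {0..1}" "y \<in> {0..1}" for x y
    using mixed12 [OF that] by (simp add: xorF_eq A_def B_def)
  have f13_eq: "f13 x z = xorF x z + C x + D z" if "x \<in> {0..1}" "z \<in> {0..1}" for x z
    using mixed13 [OF that] by (simp add: xorF_eq C_def D_def)
  have f23_eq: "f23 y z = xorF y z + E y + H z" if "y \<in> {0..1}" "z \<in> {0..1}" for y z
    using mixed23 [OF that] by (simp add: xorF_eq E_def H_def)
  have I: "(0 :: real) \<in> {0..1}" by simp
  \<comment> \<open>On each of the three lines the product vanishes and the \<open>xorF\<close>
    terms cancel, with weights -1/4, 1/2 and -1/4 on \<open>xorI x x\<close>.\<close>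
  have e: "(A x + C x) + (B 0 + E 0) + (D x + H x) = 0" "(A 0 + C 0) + (B x + E x) + (D x + H x) = 0"
     "(A x + C x) + (B x + E x) + (D 0 + H 0) = 0" if "x \<in> {0..1}" for x
    using edge [OF that]
    unfolding G_def f12_eq [OF that I] f12_eq [OF I that] f12_eq [OF that that]
      f13_eq [OF that I] f13_eq [OF I that] f13_eq [OF that that]
      f23_eq [OF that I] f23_eq [OF I that] f23_eq [OF that that]
      xorF_eq xorI_0 mult_zero_left mult_zero_right
    by argo+
  \<comment> \<open>Subtracting the relations at 0, the increments of the three sums cancel
    pairwise, so each of them is zero.\<close>
  have const: "A x + C x = A 0 + C 0" "B x + E x = B 0 + E 0" "D x + H x = D 0 + H 0" if "x \<in> {0..1}" for x
    using e [OF that] e [OF I] by argo+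
  have diag: "continuous_on {0..1} (\<lambda>x. xorI x x)"
    by (intro continuous_on_unit_sq_compose [OF continuous_on_xorI] continuous_intros) auto
  have contA: "continuous_on {0..1} A" and contB: "continuous_on {0..1} B" and contH: "continuous_on {0..1} H"
    unfolding A_def B_def H_def
    by (intro continuous_intros diag continuous_on_unit_sq_compose [OF cont12]
        continuous_on_unit_sq_compose [OF cont23]; auto)+
  show ?thesis
  \<comment> \<open>The formula for \<open>f12\<close> suggests \<open>A\<close> and
    \<open>- B\<close>; writing \<open>E\<close> as \<open>B 0 + E 0 - B\<close> in
    \<open>f23\<close> then forces the constant in the third function. The formula for
    \<open>f13\<close> follows because the three constant sums add up to 0.\<close>
  proof (intro exI conjI ballI)
    show "continuous_on {0..1} A" by (rule contA)
    show "continuous_on {0..1} (\<lambda>x. - B x)" by (intro continuous_intros contB)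
    show "continuous_on {0..1} (\<lambda>x. - H x - (B 0 + E 0))" by (intro continuous_intros contH)
  next
    fix x y :: real assume xy: "x \<in> {0..1}" "y \<in> {0..1}"
    show "f12 x y = xorF x y + A x - - B y" using f12_eq [OF xy] by simp
    show "f23 x y = xorF x y + - B x - (- H y - (B 0 + E 0))"
      using f23_eq [OF xy] const(2) [OF xy(1)] by simp
    show "f13 x y = xorF x y + (- H y - (B 0 + E 0)) - A x"
      using f13_eq [OF xy] const(1) [OF xy(1)] const(3) [OF xy(2)] e [OF I] by simp
  qed
qed

end
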